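(* Let $X$ be a right quaternionic Banach space and $T:D(T)\subseteq X\to X$ a closed right linear operator. Assume that there exists $\omega\in[0,\pi]$ such that $S_\omega:=\{te^{i\omega}\mid t>0,\ i\in\mathbb{S}\}\subseteq\rho_S(T)$, and that there exists $M\ge 0$ such that $$\|Q_s^{-1}(T)\|\le\frac{M}{|s|^2}\quad\text{and}\quad\|TQ_s^{-1}(T)\|\le\frac{M}{|s|},\qquad s\in S_\omega.$$ Let $n\in\mathbb{N}$ (so $n\geq 1$). For every $x\in X$ and $t>0$ let $$\psi_x(t):=\begin{cases}\|T^nQ_{te^{i\omega}}^{-\frac n2}(T)x\|, & n\text{ even},\\ \|T^{n+1}Q_{te^{i\omega}}^{-\frac{n+1}{2}}(T)x\|+t\,\|T^nQ_{te^{i\omega}}^{-\frac{n+1}{2}}(T)x\|, & n\text{ odd}.\end{cases}$$ Then for every $\theta\in(0,1)$ and $p\in[1,\infty]$ the real interpolation space between $X$ and $D(T^n)$ is $$(X,D(T^n))_{\theta,p}=\{x\in X\mid t\mapsto t^{n\theta}\psi_x(t)\in L^p_*(0,\infty)\},$$ and the norms $\|x\|_{\theta,p}$ and $\|x\|^*_{\theta,p}:=\|x\|+\|t^{n\theta}\psi_x(t)\|_{L^p_*(0,\infty)}$ on this space are equivalent.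
   Context: Quaternions: $\mathbb{H}$ denotes the quaternions $s=s_0+s_1e_1+s_2e_2+s_3e_3$ with $\mathrm{Re}(s)=s_0$ and modulus $|s|=\sqrt{s_0^2+s_1^2+s_2^2+s_3^2}$; $\mathbb{S}:=\{s\in\mathbb{H}\mid s_0=0,\ |s|=1\}$ is the sphere of imaginary units, and $e^{i\omega}:=\cos\omega+i\sin\omega$ for $i\in\mathbb{S}$. Right quaternionic Banach space: a right vector space $X$ over $\mathbb{H}$ (scalar multiplication from the right) with a norm satisfying $\|xs\|=\|x\||s|$ for $x\in X,s\in\mathbb{H}$, the triangle inequality and definiteness, complete with respect to this norm. Operators: a right linear operator $T:D(T)\subseteq X\to X$ is defined on a right linear subspace $D(T)$ (not assumed dense) and satisfies $T(x+y)=Tx+Ty$, $T(xs)=(Tx)s$ for $x,y\in D(T)$, $s\in\mathbb{H}$. For real $\lambda$, $(\lambda T)(x):=(T\lambda)(x):=T(x)\lambda$ with domain $D(T)$. $T$ is closed if $D(T)$ is complete with respect to $\|x\|_{D(T)}:=\|x\|+\|Tx\|$. $\mathcal{B}(X)$ denotes the everywhere defined bounded right linear operators on $X$. Powers $T^n$ have their natural domains, with $T^0=I$, $D(T^0)=X$; $D(T^n)$ carries the norm $\|x\|_{D(T^n)}:=\|x\|+\|T^nx\|$. $S$-spectrum: for $s\in\mathbb{H}$, $Q_s(T):=T^2-2s_0T+|s|^2$ with $D(Q_s(T)):=D(T^2)$. The $S$-resolvent set is $\rho_S(T):=\{s\in\mathbb{H}\mid Q_s^{-1}(T)\in\mathcal{B}(X)\}$,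 i.e. $Q_s(T):D(T^2)\to X$ is bijective with bounded inverse $Q_s^{-1}(T)$. $Q_s^{-m}(T):=(Q_s^{-1}(T))^m$ for $m\in\mathbb{N}_0$. The operator $Q_{te^{i\omega}}(T)$ does not depend on the choice of $i\in\mathbb{S}$. Interpolation: $L^p_*(0,\infty):=L^p((0,\infty),dt/t)$. Two right Banach spaces $X,Y$ form an interpolation couple if both are continuously embedded in a common topological Hausdorff space (here $Y=D(T^n)\subseteq X$, with $X$ as the common space). The $K$-functional is $K(t,x):=\inf\{\|a\|_X+t\|b\|_Y\mid x=a+b,\ a\in X,\ b\in Y\}$ for $t>0$, $x\in X+Y$. For $\theta\in(0,1)$, $p\in[1,\infty]$, $(X,Y)_{\theta,p}:=\{x\in X+Y\mid t\mapsto t^{-\theta}K(t,x)\in L^p_*(0,\infty)\}$ with norm $\|x\|_{\theta,p}:=\|t^{-\theta}K(t,x)\|_{L^p_*(0,\infty)}$. *)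

theory Defs
  imports "HOL-Analysis.Analysis" "HOL-Probability.Essential_Supremum"
begin

section \<open>Quaternions\<close>

datatype quat = Quat (quat_re: real) (quat_im1: real) (quat_im2: real) (quat_im3: real)

lemma quat_eq_iff:
  "p = q \<longleftrightarrow> quat_re p = quat_re q \<and> quat_im1 p = quat_im1 q \<and>
     quat_im2 p = quat_im2 q \<and> quat_im3 p = quat_im3 q"
  by (cases p; cases q) auto

instantiation quat :: real_normed_div_algebra
begin

definition "0 = Quat 0 0 0 0"
definition "1 = Quat 1 0 0 0"

definition "p + q = Quat (quat_re p + quat_re q) (quat_im1 p + quat_im1 q)
  (quat_im2 p + quat_im2 q) (quat_im3 p + quat_im3 q)"

definition "- p = Quat (- quat_re p) (- quat_im1 p) (- quat_im2 p) (- quat_im3 p)"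

definition "p - q = Quat (quat_re p - quat_re q) (quat_im1 p - quat_im1 q)
  (quat_im2 p - quat_im2 q) (quat_im3 p - quat_im3 q)"

definition "r *\<^sub>R p = Quat (r * quat_re p) (r * quat_im1 p) (r * quat_im2 p) (r * quat_im3 p)"

text \<open>The Hamilton product: \<open>e1 * e2 = e3\<close>, \<open>e2 * e3 = e1\<close>, \<open>e3 * e1 = e2\<close>, and the units
  \<open>e1\<close>, \<open>e2\<close>, \<open>e3\<close> anticommute and square to \<open>-1\<close>.\<close>

definition "p * q = Quat
  (quat_re p * quat_re q - quat_im1 p * quat_im1 q - quat_im2 p * quat_im2 q - quat_im3 p * quat_im3 q)
  (quat_re p * quat_im1 q + quat_im1 p * quat_re q + quat_im2 p * quat_im3 q - quat_im3 p * quat_im2 q)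
  (quat_re p * quat_im2 q - quat_im1 p * quat_im3 q + quat_im2 p * quat_re q + quat_im3 p * quat_im1 q)
  (quat_re p * quat_im3 q + quat_im1 p * quat_im2 q - quat_im2 p * quat_im1 q + quat_im3 p * quat_re q)"

definition "norm p = sqrt ((quat_re p)\<^sup>2 + (quat_im1 p)\<^sup>2 + (quat_im2 p)\<^sup>2 + (quat_im3 p)\<^sup>2)"

definition "inverse p = (1 / (norm p)\<^sup>2) *\<^sub>R
  Quat (quat_re p) (- quat_im1 p) (- quat_im2 p) (- quat_im3 p)"

definition "p div q = p * inverse (q :: quat)"

definition "sgn p = inverse (norm p) *\<^sub>R (p :: quat)"
definition "dist p q = norm (p - q :: quat)"
definition "(uniformity :: (quat \<times> quat) filter) = (INF e\<in>{0 <..}. principal {(x, y). dist x y < e})"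
definition "open U \<longleftrightarrow> (\<forall>x::quat\<in>U. eventually (\<lambda>(x', y). x' = x \<longrightarrow> y \<in> U) uniformity)"

lemma quat_sel_simps [simp]:
  "quat_re 0 = 0" "quat_im1 0 = 0" "quat_im2 0 = 0" "quat_im3 0 = 0"
  "quat_re 1 = 1" "quat_im1 1 = 0" "quat_im2 1 = 0" "quat_im3 1 = 0"
  "quat_re (p + q) = quat_re p + quat_re q" "quat_im1 (p + q) = quat_im1 p + quat_im1 q"
  "quat_im2 (p + q) = quat_im2 p + quat_im2 q" "quat_im3 (p + q) = quat_im3 p + quat_im3 q"
  "quat_re (p - q) = quat_re p - quat_re q" "quat_im1 (p - q) = quat_im1 p - quat_im1 q"
  "quat_im2 (p - q) = quat_im2 p - quat_im2 q" "quat_im3 (p - q) = quat_im3 p - quat_im3 q"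
  "quat_re (- p) = - quat_re p" "quat_im1 (- p) = - quat_im1 p"
  "quat_im2 (- p) = - quat_im2 p" "quat_im3 (- p) = - quat_im3 p"
  "quat_re (r *\<^sub>R p) = r * quat_re p" "quat_im1 (r *\<^sub>R p) = r * quat_im1 p"
  "quat_im2 (r *\<^sub>R p) = r * quat_im2 p" "quat_im3 (r *\<^sub>R p) = r * quat_im3 p"
  by (simp_all add: zero_quat_def one_quat_def plus_quat_def minus_quat_def uminus_quat_def
      scaleR_quat_def)

lemma norm_quat_eq_norm_prod:
  "norm p = norm ((quat_re p, quat_im1 p), (quat_im2 p, quat_im3 p))"
  by (simp add: norm_quat_def norm_Pair algebra_simps)

lemma norm_quat_power2:
  "(norm p)\<^sup>2 = (quat_re p)\<^sup>2 + (quat_im1 p)\<^sup>2 + (quat_im2 p)\<^sup>2 + (quat_im3 p)\<^sup>2"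
  by (simp add: norm_quat_def)

lemma norm_quat_eq_0: "norm p = 0 \<longleftrightarrow> p = (0 :: quat)"
  by (auto simp: norm_quat_eq_norm_prod quat_eq_iff zero_prod_def)

lemma quat_inverse_mult: assumes "p \<noteq> (0 :: quat)"
  shows "inverse p * p = 1" "p * inverse p = 1"
proof -
  define N where "N = (norm p)\<^sup>2"
  have N: "N \<noteq> 0" using assms by (simp add: N_def norm_quat_eq_0)
  have N': "quat_re p * quat_re p + quat_im1 p * quat_im1 p + quat_im2 p * quat_im2 p
      + quat_im3 p * quat_im3 p = N"
    unfolding N_def norm_quat_power2 by (simp add: power2_eq_square)
  show "inverse p * p = 1" "p * inverse p = 1"
    unfolding inverse_quat_def N_def[symmetric]
    using N N' by (simp_all add: times_quat_def quat_eq_iff field_simps)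
qed

instance
proof
  fix p q r :: quat and a b :: real
  show "p + q + r = p + (q + r)" "p + q = q + p" "0 + p = p" "- p + p = 0" "p - q = p + - q"
    by (simp_all add: quat_eq_iff)
  show "p * q * r = p * (q * r)" "1 * p = p" "p * 1 = p"
    "(p + q) * r = p * r + q * r" "p * (q + r) = p * q + p * r"
    by (simp_all add: quat_eq_iff times_quat_def algebra_simps)
  show "(0 :: quat) \<noteq> 1" by (simp add: quat_eq_iff)
  show "a *\<^sub>R (p + q) = a *\<^sub>R p + a *\<^sub>R q" "(a + b) *\<^sub>R p = a *\<^sub>R p + b *\<^sub>R p"
    "a *\<^sub>R b *\<^sub>R p = (a * b) *\<^sub>R p" "1 *\<^sub>R p = p"
    by (simp_all add: quat_eq_iff algebra_simps)
  show "a *\<^sub>R p * q = a *\<^sub>R (p * q)" "p * a *\<^sub>R q = a *\<^sub>R (p * q)"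
    by (simp_all add: quat_eq_iff times_quat_def algebra_simps)
  show "p \<noteq> 0 \<Longrightarrow> inverse p * p = 1" "p \<noteq> 0 \<Longrightarrow> p * inverse p = 1"
    by (simp_all add: quat_inverse_mult)
  show "p div q = p * inverse q" by (rule divide_quat_def)
  show "inverse (0 :: quat) = 0" by (simp add: inverse_quat_def quat_eq_iff)
  show "dist p q = norm (p - q)" by (rule dist_quat_def)
  show "sgn p = inverse (norm p) *\<^sub>R p" by (rule sgn_quat_def)
  show "(uniformity :: (quat \<times> quat) filter) = (INF e\<in>{0 <..}. principal {(x, y). dist x y < e})"
    by (rule uniformity_quat_def)
  show "open U \<longleftrightarrow> (\<forall>x\<in>U. eventually (\<lambda>(x', y). x' = x \<longrightarrow> y \<in> U) uniformity)" for U :: "quat set"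
    by (rule open_quat_def)
  show "norm p = 0 \<longleftrightarrow> p = 0" by (rule norm_quat_eq_0)
  show "norm (p + q) \<le> norm p + norm q"
    using norm_triangle_ineq[of "((quat_re p, quat_im1 p), (quat_im2 p, quat_im3 p))"
        "((quat_re q, quat_im1 q), (quat_im2 q, quat_im3 q))"]
    by (simp add: norm_quat_eq_norm_prod)
  show "norm (a *\<^sub>R p) = \<bar>a\<bar> * norm p"
    using norm_scaleR[of a "((quat_re p, quat_im1 p), (quat_im2 p, quat_im3 p))"]
    by (simp add: norm_quat_eq_norm_prod)
  show "norm (p * q) = norm p * norm q"
    unfolding norm_quat_def real_sqrt_mult[symmetric]
    by (rule arg_cong[where f = sqrt])
       (simp add: times_quat_def power2_eq_square algebra_simps)
qed

end

lemma norm_quat_Quat: "norm (Quat a b c d) = sqrt (a\<^sup>2 + b\<^sup>2 + c\<^sup>2 + d\<^sup>2)"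
  by (simp add: norm_quat_def)

definition imaginary_units :: "quat set" where
  "imaginary_units = {s. quat_re s = 0 \<and> norm s = 1}"

definition quat_cis :: "quat \<Rightarrow> real \<Rightarrow> quat" where
  "quat_cis i \<omega> = of_real (cos \<omega>) + i * of_real (sin \<omega>)"

definition S_cone :: "real \<Rightarrow> quat set" where
  "S_cone \<omega> = {of_real t * quat_cis i \<omega> | t i. t > 0 \<and> i \<in> imaginary_units}"


section \<open>Right quaternionic Banach spaces\<close>

text \<open>The real Banach space structure of the class \<^class>\<open>banach\<close> is the one obtained from the
  right quaternionic structure by restriction of scalars (axiom \<open>scaleQ_of_real\<close>); in particular
  \<open>x \<bullet>\<^sub>Q 1 = x\<close>.\<close>

class right_quaternionic_banach = banach +
  fixes scaleQ :: "'a \<Rightarrow> quat \<Rightarrow> 'a"  (infixl \<open>\<bullet>\<^sub>Q\<close> 75)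
  assumes scaleQ_add_left: "(x + y) \<bullet>\<^sub>Q s = x \<bullet>\<^sub>Q s + y \<bullet>\<^sub>Q s"
    and scaleQ_add_right: "x \<bullet>\<^sub>Q (s + t) = x \<bullet>\<^sub>Q s + x \<bullet>\<^sub>Q t"
    and scaleQ_scaleQ: "x \<bullet>\<^sub>Q s \<bullet>\<^sub>Q t = x \<bullet>\<^sub>Q (s * t)"
    and scaleQ_of_real: "x \<bullet>\<^sub>Q of_real r = r *\<^sub>R x"
    and norm_scaleQ: "norm (x \<bullet>\<^sub>Q s) = norm x * norm s"

text \<open>The quaternions themselves form such a space.\<close>

instance quat :: banach
proof
  fix X :: "nat \<Rightarrow> quat" assume X: "Cauchy X"
  define F where "F q = ((quat_re q, quat_im1 q), (quat_im2 q, quat_im3 q))" for q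
  have F: "dist (F p) (F q) = dist p q" for p q
    by (simp add: F_def dist_norm norm_quat_eq_norm_prod)
  have "Cauchy (\<lambda>k. F (X k))" using X by (simp add: Cauchy_def F)
  then obtain z where z: "(\<lambda>k. F (X k)) \<longlonglongrightarrow> z"
    using Cauchy_convergent convergentD by blast
  obtain a b c d where "z = ((a, b), (c, d))" by (metis prod.exhaust)
  then have "z = F (Quat a b c d)" by (simp add: F_def)
  with z have "X \<longlonglongrightarrow> Quat a b c d" by (simp add: tendsto_iff F)
  then show "convergent X" by (rule convergentI)
qed

instantiation quat :: right_quaternionic_banach
begin

definition "scaleQ p q = p * (q :: quat)"

instance
  by standard (simp_all add: scaleQ_quat_def algebra_simps norm_mult of_real_def)

end


section \<open>Unbounded right linear operators\<close>

text \<open>A partially defined operator is a domain \<open>D\<close> together with a total function \<open>T\<close>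
  whose values outside \<open>D\<close> are irrelevant.  Consequently \<open>T ^^ n\<close> is the power of the operator
  only on the natural domain \<open>power_dom D T n\<close>, and below it is only evaluated there.\<close>

definition right_subspace :: "'a::right_quaternionic_banach set \<Rightarrow> bool" where
  "right_subspace D \<longleftrightarrow> 0 \<in> D \<and> (\<forall>x\<in>D. \<forall>y\<in>D. x + y \<in> D) \<and> (\<forall>x\<in>D. \<forall>s. x \<bullet>\<^sub>Q s \<in> D)"

definition right_linear_on :: "'a::right_quaternionic_banach set \<Rightarrow> ('a \<Rightarrow> 'a) \<Rightarrow> bool" where
  "right_linear_on D T \<longleftrightarrow> right_subspace D \<and>
     (\<forall>x\<in>D. \<forall>y\<in>D. T (x + y) = T x + T y) \<and> (\<forall>x\<in>D. \<forall>s. T (x \<bullet>\<^sub>Q s) = T x \<bullet>\<^sub>Q s)"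

text \<open>The algebra \<open>B(X)\<close>.\<close>

definition bounded_right_linear :: "('a::right_quaternionic_banach \<Rightarrow> 'a) \<Rightarrow> bool" where
  "bounded_right_linear A \<longleftrightarrow> right_linear_on UNIV A \<and> (\<exists>C. \<forall>x. norm (A x) \<le> C * norm x)"

primrec power_dom :: "'a set \<Rightarrow> ('a \<Rightarrow> 'a) \<Rightarrow> nat \<Rightarrow> 'a set" where
  "power_dom D T 0 = UNIV"
| "power_dom D T (Suc n) = {x \<in> power_dom D T n. (T ^^ n) x \<in> D}"

definition power_graph_norm ::
    "('a::right_quaternionic_banach \<Rightarrow> 'a) \<Rightarrow> nat \<Rightarrow> 'a \<Rightarrow> real" where
  "power_graph_norm T n x = norm x + norm ((T ^^ n) x)"

definition complete_wrt :: "('a::ab_group_add) set \<Rightarrow> ('a \<Rightarrow> real) \<Rightarrow> bool" where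
  "complete_wrt V N \<longleftrightarrow>
     (\<forall>u :: nat \<Rightarrow> 'a.
        (\<forall>k. u k \<in> V) \<and> (\<forall>e>0. \<exists>K. \<forall>k\<ge>K. \<forall>l\<ge>K. N (u k - u l) < e) \<longrightarrow>
        (\<exists>x\<in>V. (\<lambda>k. N (u k - x)) \<longlonglongrightarrow> 0))"

definition closed_right_linear :: "'a::right_quaternionic_banach set \<Rightarrow> ('a \<Rightarrow> 'a) \<Rightarrow> bool" where
  "closed_right_linear D T \<longleftrightarrow>
     right_linear_on D T \<and> complete_wrt D (\<lambda>x. norm x + norm (T x))"


section \<open>The S-spectrum\<close>

definition Q_op :: "('a::right_quaternionic_banach \<Rightarrow> 'a) \<Rightarrow> quat \<Rightarrow> 'a \<Rightarrow> 'a" where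
  "Q_op T s x = (T ^^ 2) x - (2 * quat_re s) *\<^sub>R T x + (norm s)\<^sup>2 *\<^sub>R x"

definition Q_inv ::
    "'a::right_quaternionic_banach set \<Rightarrow> ('a \<Rightarrow> 'a) \<Rightarrow> quat \<Rightarrow> 'a \<Rightarrow> 'a" where
  "Q_inv D T s = the_inv_into (power_dom D T 2) (Q_op T s)"

definition S_resolvent_set ::
    "'a::right_quaternionic_banach set \<Rightarrow> ('a \<Rightarrow> 'a) \<Rightarrow> quat set" where
  "S_resolvent_set D T =
     {s. bij_betw (Q_op T s) (power_dom D T 2) UNIV \<and> bounded_right_linear (Q_inv D T s)}"

definition psi :: "'a::right_quaternionic_banach set \<Rightarrow> ('a \<Rightarrow> 'a) \<Rightarrow> quat \<Rightarrow> real \<Rightarrow> nat \<Rightarrow>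
    'a \<Rightarrow> real \<Rightarrow> real" where
  "psi D T i \<omega> n x t =
     (let R = Q_inv D T (of_real t * quat_cis i \<omega>) in
      if even n then norm ((T ^^ n) ((R ^^ (n div 2)) x))
      else norm ((T ^^ (n + 1)) ((R ^^ ((n + 1) div 2)) x))
           + t * norm ((T ^^ n) ((R ^^ ((n + 1) div 2)) x)))"


section \<open>Real interpolation\<close>

definition haar_pos :: "real measure" where
  "haar_pos = density (restrict_space lborel {0<..}) (\<lambda>t. ennreal (1 / t))"

definition in_Lp :: "ennreal \<Rightarrow> 'b measure \<Rightarrow> ('b \<Rightarrow> real) \<Rightarrow> bool" where
  "in_Lp p M f \<longleftrightarrow> f \<in> borel_measurable M \<and>
     (if p = \<infinity> then esssup M (\<lambda>t. ennreal \<bar>f t\<bar>) < \<infinity>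
      else integrable M (\<lambda>t. \<bar>f t\<bar> powr enn2real p))"

definition Lp_norm :: "ennreal \<Rightarrow> 'b measure \<Rightarrow> ('b \<Rightarrow> real) \<Rightarrow> real" where
  "Lp_norm p M f =
     (if p = \<infinity> then enn2real (esssup M (\<lambda>t. ennreal \<bar>f t\<bar>))
      else (LINT t|M. \<bar>f t\<bar> powr enn2real p) powr (1 / enn2real p))"

text \<open>An interpolation couple consists of two subspaces \<open>V\<close>, \<open>W\<close> of one ambient space,
  with norms \<open>NV\<close>, \<open>NW\<close>.\<close>

definition K_functional :: "('a::ab_group_add) set \<Rightarrow> ('a \<Rightarrow> real) \<Rightarrow> 'a set \<Rightarrow> ('a \<Rightarrow> real) \<Rightarrow>
    real \<Rightarrow> 'a \<Rightarrow> real" where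
  "K_functional V NV W NW t x = Inf {NV a + t * NW b | a b. a \<in> V \<and> b \<in> W \<and> x = a + b}"

definition interpolation_space :: "('a::ab_group_add) set \<Rightarrow> ('a \<Rightarrow> real) \<Rightarrow> 'a set \<Rightarrow>
    ('a \<Rightarrow> real) \<Rightarrow> real \<Rightarrow> ennreal \<Rightarrow> 'a set" where
  "interpolation_space V NV W NW \<theta> p =
     {x \<in> {a + b | a b. a \<in> V \<and> b \<in> W}.
        in_Lp p haar_pos (\<lambda>t. t powr (- \<theta>) * K_functional V NV W NW t x)}"

definition interpolation_norm :: "('a::ab_group_add) set \<Rightarrow> ('a \<Rightarrow> real) \<Rightarrow> 'a set \<Rightarrow>
    ('a \<Rightarrow> real) \<Rightarrow> real \<Rightarrow> ennreal \<Rightarrow> 'a \<Rightarrow> real" where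
  "interpolation_norm V NV W NW \<theta> p x =
     Lp_norm p haar_pos (\<lambda>t. t powr (- \<theta>) * K_functional V NV W NW t x)"

definition equivalent_norms_on :: "'a set \<Rightarrow> ('a \<Rightarrow> real) \<Rightarrow> ('a \<Rightarrow> real) \<Rightarrow> bool" where
  "equivalent_norms_on V N1 N2 \<longleftrightarrow>
     (\<exists>c>0. \<exists>C>0. \<forall>x\<in>V. c * N1 x \<le> N2 x \<and> N2 x \<le> C * N1 x)"

end

theory Submission
  imports Defs
begin

text \<open>
  Put \<open>P = T\<^sup>2 R\<close> for the resolvent \<open>R = Q\<^sub>t\<inverse>\<close> and \<open>m = \<lceil>n/2\<rceil>\<close>. Since \<open>I - P\<close> equals
  \<open>(t\<^sup>2 - 2 t cos \<omega> T) R\<close>, its even powers gain powers of \<open>R\<close>: \<open>(I - P)\<^sup>2\<^sup>m = V\<^sup>m (t\<^sup>2R)\<^sup>m\<close> with \<open>V\<close> bounded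
  uniformly in \<open>t\<close>. Hence \<open>b = (I - P\<^sup>m)\<^sup>2\<^sup>m x\<close> lies in the domain of \<open>T\<^sup>n\<close>, and in the splitting
  \<open>x = (x - b) + b\<close> both \<open>\<parallel>x - b\<parallel>\<close> and \<open>t\<^sup>-\<^sup>n \<parallel>T\<^sup>n b\<parallel>\<close> are bounded by a multiple of \<open>\<psi>\<^sub>x(t)\<close>. Conversely
  \<open>\<psi>\<^sub>x(t)\<close> is bounded by a multiple of \<open>\<parallel>a\<parallel> + t\<^sup>-\<^sup>n \<parallel>T\<^sup>n b\<parallel>\<close> for every splitting \<open>x = a + b\<close>. So
  \<open>K(t\<^sup>-\<^sup>n, x)\<close> is comparable, pointwise in \<open>t\<close>, to \<open>\<psi>\<^sub>x(t) + min(1, t\<^sup>-\<^sup>n) \<parallel>x\<parallel>\<close>, and the substitution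
  \<open>s = t\<^sup>-\<^sup>n\<close> gives the equivalence of norms.
\<close>

section \<open>Uniformly bounded functions of the resolvents\<close>

text \<open>Along one ray the coefficients of Q are the real numbers \<open>2 * t * c\<close> and
  \<open>t\<^sup>2\<close>, with \<open>c\<close> the cosine of the angle, so the argument lives in
  the underlying real vector space. \<open>R t\<close> is the inverse of Q.\<close>

locale ray_resolvent =
  fixes D :: "'a::real_normed_vector set" and T :: "'a \<Rightarrow> 'a" and c M :: real
    and R :: "real \<Rightarrow> 'a \<Rightarrow> 'a"
  assumes subspace_D: "subspace D"
    and T_add: "x \<in> D \<Longrightarrow> y \<in> D \<Longrightarrow> T (x + y) = T x + T y"
    and T_scaleR: "x \<in> D \<Longrightarrow> T (r *\<^sub>R x) = r *\<^sub>R T x"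
    and linear_R: "t > 0 \<Longrightarrow> linear (R t)"
    and R_in_D: "t > 0 \<Longrightarrow> R t x \<in> D"
    and TR_in_D: "t > 0 \<Longrightarrow> T (R t x) \<in> D"
    and right_inverse: "t > 0 \<Longrightarrow>
      T (T (R t x)) - (2 * t * c) *\<^sub>R T (R t x) + t\<^sup>2 *\<^sub>R R t x = x"
    and left_inverse: "t > 0 \<Longrightarrow> y \<in> D \<Longrightarrow> T y \<in> D \<Longrightarrow>
      R t (T (T y) - (2 * t * c) *\<^sub>R T y + t\<^sup>2 *\<^sub>R y) = y"
    and norm_R: "t > 0 \<Longrightarrow> norm (R t x) \<le> M / t\<^sup>2 * norm x"
    and norm_TR: "t > 0 \<Longrightarrow> norm (T (R t x)) \<le> M / t * norm x"
begin

lemmas D_closed = subspace_add[OF subspace_D] subspace_scale[OF subspace_D]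
  subspace_diff[OF subspace_D] subspace_0[OF subspace_D]

lemma T_diff: "x \<in> D \<Longrightarrow> y \<in> D \<Longrightarrow> T (x - y) = T x - T y"
  using T_add[of x "(-1) *\<^sub>R y"] T_scaleR[of y "-1"] D_closed(2)[of y "-1"] by simp

lemma T_0 [simp]: "T 0 = 0"
  using T_scaleR[of 0 0] D_closed(4) by simp

text \<open>Solving Q R x = x for \<open>T (T (R t x))\<close> shows that \<open>T (R t x)\<close>
  lies in the domain of Q when \<open>x\<close> is in \<open>D\<close>. Applying \<open>T\<close> to
  Q R x = x gives Q (T R x) = T x, and the left inverse recovers T R x.\<close>

lemma TR_commute:
  assumes "t > 0" "x \<in> D" shows "T (R t x) = R t (T x)"
proof -
  let ?y = "R t x"
  have "T (T ?y) = x + (2 * t * c) *\<^sub>R T ?y - t\<^sup>2 *\<^sub>R ?y"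
    using right_inverse[OF assms(1), of x] by (simp add: algebra_simps)
  then have TT: "T (T ?y) \<in> D"
    using assms R_in_D TR_in_D by (auto intro!: D_closed)
  have "T x = T (T (T ?y) - (2 * t * c) *\<^sub>R T ?y + t\<^sup>2 *\<^sub>R ?y)"
    using right_inverse[OF assms(1), of x] by simp
  also have "\<dots> = T (T (T ?y)) - (2 * t * c) *\<^sub>R T (T ?y) + t\<^sup>2 *\<^sub>R T ?y"
    using TT assms R_in_D TR_in_D by (simp add: T_add T_diff T_scaleR D_closed)
  finally have "R t (T x) = T ?y"
    using left_inverse[OF assms(1) TR_in_D[OF assms(1)] TT] by simp
  then show ?thesis ..
qed

section \<open>Scale-invariant families built from \<open>T\<close> and the resolvent\<close>

definition U where "U t x = t\<^sup>2 *\<^sub>R R t x"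
definition S where "S t x = t *\<^sub>R T (R t x)"
definition P where "P t x = T (T (R t x))"
definition W where "W t x = x - P t x"
text \<open>The quotient of the square of \<open>W\<close> by \<open>U\<close>: since
  \<open>W t\<close> is \<open>U t\<close> minus \<open>2 * c\<close> times \<open>S t\<close>,
  squaring it and replacing S^2 by P U leaves this bracket.\<close>

definition V where "V t x = U t x - (4 * c) *\<^sub>R S t x + (4 * c\<^sup>2) *\<^sub>R P t x"

text \<open>A rearrangement of Q R = I. The assumed bounds make \<open>U\<close> and
  \<open>S\<close> uniformly bounded in \<open>t\<close>; through this identity \<open>P\<close>
  inherits boundedness and strong continuity.\<close>

lemma P_eq: "t > 0 \<Longrightarrow> P t x = x + (2 * c) *\<^sub>R S t x - U t x"
  using right_inverse[of t x] by (simp add: P_def S_def U_def algebra_simps)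

text \<open>Commutation with \<open>T\<close> on \<open>D\<close> already implies commutation with \<open>R\<close>, hence with \<open>U\<close> and \<open>P\<close>.\<close>

definition regular :: "(real \<Rightarrow> 'a \<Rightarrow> 'a) \<Rightarrow> bool" where
  "regular A \<longleftrightarrow>
     (\<forall>t>0. linear (A t) \<and> (\<forall>x\<in>D. A t x \<in> D \<and> T (A t x) = A t (T x))) \<and>
     (\<exists>C. \<forall>t>0. \<forall>x. norm (A t x) \<le> C * norm x) \<and>
     (\<forall>x. continuous_on {0<..} (\<lambda>t. A t x))"

section \<open>The algebra of regular families\<close>

lemma regular_linear: "regular A \<Longrightarrow> t > 0 \<Longrightarrow> linear (A t)"
  by (simp add: regular_def)

lemma regular_in_D: "regular A \<Longrightarrow> t > 0 \<Longrightarrow> x \<in> D \<Longrightarrow> A t x \<in> D"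
  by (simp add: regular_def)

lemma regular_T: "regular A \<Longrightarrow> t > 0 \<Longrightarrow> x \<in> D \<Longrightarrow> T (A t x) = A t (T x)"
  by (simp add: regular_def)

lemma regular_continuous: "regular A \<Longrightarrow> continuous_on {0<..} (\<lambda>t. A t x)"
  by (simp add: regular_def)

lemma regular_bound:
  assumes "regular A"
  obtains C where "C > 0" "\<And>t x. t > 0 \<Longrightarrow> norm (A t x) \<le> C * norm x"
proof -
  obtain C where C: "\<And>t x. t > 0 \<Longrightarrow> norm (A t x) \<le> C * norm x"
    using assms unfolding regular_def by blast
  show thesis
  proof
    show "norm (A t x) \<le> (\<bar>C\<bar> + 1) * norm x" if "t > 0" for t x
      using order_trans[OF C[OF that, of x], of "(\<bar>C\<bar> + 1) * norm x"]
      by (simp add: mult_right_mono)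
  qed simp
qed

lemma regular_id: "regular (\<lambda>t x. x)"
  unfolding regular_def by (auto intro!: exI[of _ 1] linear_id[unfolded id_def])

text \<open>Strong continuity passes to products through the uniform bound: A_t B_t x - A_s B_s x
  splits into A_t (B_t x - B_s x), which the bound on \<open>A\<close> makes small, and (A_t - A_s)
  B_s x, where the argument is fixed.\<close>

lemma regular_compose:
  assumes A: "regular A" and B: "regular B"
  shows "regular (\<lambda>t x. A t (B t x))"
  unfolding regular_def
proof (intro conjI allI impI ballI)
  fix t :: real assume t: "t > 0"
  show "linear (\<lambda>x. A t (B t x))"
    using linear_compose[OF regular_linear[OF B t] regular_linear[OF A t]] by (simp add: o_def)
  fix x assume "x \<in> D"
  with t show "A t (B t x) \<in> D" "T (A t (B t x)) = A t (B t (T x))"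
    using A B by (simp_all add: regular_in_D regular_T)
next
  obtain C where C: "C > 0" "\<And>t x. t > 0 \<Longrightarrow> norm (A t x) \<le> C * norm x"
    using regular_bound[OF A] by blast
  obtain C' where C': "C' > 0" "\<And>t x. t > 0 \<Longrightarrow> norm (B t x) \<le> C' * norm x"
    using regular_bound[OF B] by blast
  have "norm (A t (B t x)) \<le> (C * C') * norm x" if "t > 0" for t x
  proof -
    have "norm (A t (B t x)) \<le> C * norm (B t x)" using C that by blast
    also have "\<dots> \<le> C * (C' * norm x)" using C(1) C'(2)[OF that, of x] by simp
    finally show ?thesis by simp
  qed
  then show "\<exists>C. \<forall>t>0. \<forall>x. norm (A t (B t x)) \<le> C * norm x" by blast
  fix x
  show "continuous_on {0<..} (\<lambda>t. A t (B t x))"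
    unfolding continuous_on_def
  proof
    fix s :: real assume s: "s \<in> {0<..}"
    have "((\<lambda>t. B t x - B s x) \<longlongrightarrow> 0) (at s within {0<..})"
      using regular_continuous[OF B, of x] s by (auto simp: continuous_on_def intro: LIM_zero)
    then have "((\<lambda>t. C * norm (B t x - B s x)) \<longlongrightarrow> 0) (at s within {0<..})"
      by (intro tendsto_mult_right_zero tendsto_norm_zero)
    moreover have "\<forall>\<^sub>F t in at s within {0<..}.
        norm (A t (B t x - B s x)) \<le> C * norm (B t x - B s x)"
      using C(2) by (auto simp: eventually_at_filter)
    ultimately have "((\<lambda>t. A t (B t x - B s x)) \<longlongrightarrow> 0) (at s within {0<..})"
      by (rule Lim_null_comparison[rotated])
    moreover have "((\<lambda>t. A t (B s x)) \<longlongrightarrow> A s (B s x)) (at s within {0<..})"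
      using regular_continuous[OF A, of "B s x"] s by (auto simp: continuous_on_def)
    ultimately have "((\<lambda>t. A t (B t x - B s x) + A t (B s x)) \<longlongrightarrow> 0 + A s (B s x))
        (at s within {0<..})"
      by (rule tendsto_add)
    then have "((\<lambda>t. A t (B t x - B s x) + A t (B s x)) \<longlongrightarrow> A s (B s x)) (at s within {0<..})"
      by simp
    then show "((\<lambda>t. A t (B t x)) \<longlongrightarrow> A s (B s x)) (at s within {0<..})"
    proof (rule Lim_transform_eventually)
      show "\<forall>\<^sub>F t in at s within {0<..}. A t (B t x - B s x) + A t (B s x) = A t (B t x)"
        unfolding eventually_at_filter
        by (rule always_eventually) (simp add: linear_diff[OF regular_linear[OF A]])
    qed
  qed
qed

lemma regular_add:
  assumes A: "regular A" and B: "regular B"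
  shows "regular (\<lambda>t x. A t x + B t x)"
  unfolding regular_def
proof (intro conjI allI impI ballI)
  fix t :: real assume t: "t > 0"
  show "linear (\<lambda>x. A t x + B t x)"
    by (intro linear_compose_add regular_linear A B t)
  fix x assume "x \<in> D"
  with t show "A t x + B t x \<in> D" "T (A t x + B t x) = A t (T x) + B t (T x)"
    using A B by (simp_all add: regular_in_D regular_T T_add D_closed)
next
  obtain C where C: "C > 0" "\<And>t x. t > 0 \<Longrightarrow> norm (A t x) \<le> C * norm x"
    using regular_bound[OF A] by blast
  obtain C' where C': "C' > 0" "\<And>t x. t > 0 \<Longrightarrow> norm (B t x) \<le> C' * norm x"
    using regular_bound[OF B] by blast
  have "norm (A t x + B t x) \<le> (C + C') * norm x" if "t > 0" for t x
    using norm_triangle_ineq[of "A t x" "B t x"] C(2)[OF that, of x] C'(2)[OF that, of x]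
    by (simp add: distrib_right)
  then show "\<exists>C. \<forall>t>0. \<forall>x. norm (A t x + B t x) \<le> C * norm x" by blast
qed (intro continuous_on_add regular_continuous A B)

lemma regular_scaleR:
  assumes A: "regular A" shows "regular (\<lambda>t x. r *\<^sub>R A t x)"
  unfolding regular_def
proof (intro conjI allI impI ballI)
  fix t :: real assume t: "t > 0"
  show "linear (\<lambda>x. r *\<^sub>R A t x)"
    by (intro linear_compose_scale_right regular_linear A t)
  fix x assume "x \<in> D"
  with t show "r *\<^sub>R A t x \<in> D" "T (r *\<^sub>R A t x) = r *\<^sub>R A t (T x)"
    using A by (simp_all add: regular_in_D regular_T T_scaleR D_closed)
next
  obtain C where C: "C > 0" "\<And>t x. t > 0 \<Longrightarrow> norm (A t x) \<le> C * norm x"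
    using regular_bound[OF A] by blast
  have "norm (r *\<^sub>R A t x) \<le> (\<bar>r\<bar> * C) * norm x" if "t > 0" for t x
    using mult_left_mono[OF C(2)[OF that, of x], of "\<bar>r\<bar>"] by (simp add: mult.assoc)
  then show "\<exists>C. \<forall>t>0. \<forall>x. norm (r *\<^sub>R A t x) \<le> C * norm x" by blast
qed (intro continuous_on_scaleR continuous_on_const regular_continuous A)

lemma regular_diff:
  assumes "regular A" "regular B" shows "regular (\<lambda>t x. A t x - B t x)"
  using regular_add[OF assms(1) regular_scaleR[OF assms(2), of "-1"]] by simp

lemma regular_funpow: "regular A \<Longrightarrow> regular (\<lambda>t. A t ^^ k)"
proof (induction k)
  case 0
  then show ?case using regular_id by (simp add: id_def)
next
  case (Suc k)
  then show ?case using regular_compose[of A "\<lambda>t. A t ^^ k"] by (simp add: o_def)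
qed

text \<open>Both continuity claims come from \<open>R s = R t (I + (Q t - Q s) R s)\<close>.\<close>

lemma resolvent_identity:
  assumes "t > 0" "s > 0"
  shows "R s x = R t (x + ((2 * (s - t) * c) *\<^sub>R T (R s x) + (t\<^sup>2 - s\<^sup>2) *\<^sub>R R s x))"
proof -
  have "x + ((2 * (s - t) * c) *\<^sub>R T (R s x) + (t\<^sup>2 - s\<^sup>2) *\<^sub>R R s x) =
      (T (T (R s x)) - (2 * s * c) *\<^sub>R T (R s x) + s\<^sup>2 *\<^sub>R R s x)
      + ((2 * (s - t) * c) *\<^sub>R T (R s x) + (t\<^sup>2 - s\<^sup>2) *\<^sub>R R s x)"
    using right_inverse[OF assms(2), of x] by simp
  also have "\<dots> = T (T (R s x)) - (2 * t * c) *\<^sub>R T (R s x) + t\<^sup>2 *\<^sub>R R s x"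
    by (simp add: algebra_simps)
  finally show ?thesis
    using left_inverse[OF assms(1) R_in_D[OF assms(2)] TR_in_D[OF assms(2)], of x] by simp
qed

lemma continuous_R:
  shows "continuous_on {0<..} (\<lambda>t. R t x)" and "continuous_on {0<..} (\<lambda>t. T (R t x))"
proof -
  \<comment> \<open>This is (Q_t - Q_s) R_s x, which vanishes at t = s.\<close>
  define h where "h s t = (2 * (s - t) * c) *\<^sub>R T (R s x) + (t\<^sup>2 - s\<^sup>2) *\<^sub>R R s x" for s t
  \<comment> \<open>The free \<open>K\<close> and \<open>k\<close> serve both estimates:
    \<open>M / t\<^sup>2\<close> for R_t and \<open>M / t\<close> for T R_t.\<close>
  have h: "((\<lambda>t. K / t ^ k * norm (h s t)) \<longlongrightarrow> 0) (at s within {0<..})" if "s > 0" for s k K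
  proof -
    have "((\<lambda>t. K / t ^ k * norm (h s t)) \<longlongrightarrow> K / s ^ k * norm (h s s)) (at s within {0<..})"
      unfolding h_def using that by (intro tendsto_intros) auto
    then show ?thesis by (simp add: h_def)
  qed
  have eq: "R t x - R s x = - R t (h s t)" if "t > 0" "s > 0" for s t
    using resolvent_identity[OF that, of x] linear_add[OF linear_R[OF that(1)], of x "h s t"]
    unfolding h_def by (metis add_diff_cancel_left' minus_diff_eq)
  have "((\<lambda>t. R t x - R s x) \<longlongrightarrow> 0) (at s within {0<..})" if s: "s > 0" for s
    by (rule Lim_null_comparison[OF _ h[OF s, of M 2]])
       (use eq s norm_R in \<open>auto simp: eventually_at_filter\<close>)
  then show "continuous_on {0<..} (\<lambda>t. R t x)"
    unfolding continuous_on_def by (auto intro: LIM_zero_cancel)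
  have eq': "T (R t x) - T (R s x) = - T (R t (h s t))" if "t > 0" "s > 0" for s t
  proof -
    have "T (R t x) - T (R s x) = T ((-1) *\<^sub>R R t (h s t))"
      using T_diff[of "R t x" "R s x"] R_in_D that eq[OF that] by simp
    also have "\<dots> = - T (R t (h s t))" using T_scaleR[of "R t (h s t)" "-1"] R_in_D that by simp
    finally show ?thesis .
  qed
  have "((\<lambda>t. T (R t x) - T (R s x)) \<longlongrightarrow> 0) (at s within {0<..})" if s: "s > 0" for s
    by (rule Lim_null_comparison[OF _ h[OF s, of M 1]])
       (use eq' s norm_TR in \<open>auto simp: eventually_at_filter\<close>)
  then show "continuous_on {0<..} (\<lambda>t. T (R t x))"
    unfolding continuous_on_def by (auto intro: LIM_zero_cancel)
qed

lemma regular_U: "regular U"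
  unfolding regular_def
proof (intro conjI allI impI ballI)
  fix t :: real assume t: "t > 0"
  show "linear (U t)"
    unfolding U_def using linear_compose_scale_right[OF linear_R[OF t]] by simp
  fix x assume "x \<in> D"
  with t show "U t x \<in> D" "T (U t x) = U t (T x)"
    by (simp_all add: U_def R_in_D TR_commute T_scaleR D_closed)
next
  have "norm (U t x) \<le> M * norm x" if "t > 0" for t x
    using norm_R[OF that, of x] that by (simp add: U_def field_simps)
  then show "\<exists>C. \<forall>t>0. \<forall>x. norm (U t x) \<le> C * norm x" by blast
qed (auto simp: U_def intro!: continuous_intros continuous_R)

lemma regular_S: "regular S"
  unfolding regular_def
proof (intro conjI allI impI ballI)
  fix t :: real assume t: "t > 0"
  show "linear (S t)"
    using t unfolding S_def
    by (intro linearI)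
       (simp_all add: linear_add[OF linear_R] linear_scale[OF linear_R] T_add T_scaleR R_in_D
         algebra_simps)
  fix x assume "x \<in> D"
  with t show "S t x \<in> D" "T (S t x) = S t (T x)"
    by (simp_all add: S_def R_in_D TR_in_D TR_commute[symmetric] T_scaleR D_closed)
next
  have "norm (S t x) \<le> M * norm x" if "t > 0" for t x
    using norm_TR[OF that, of x] that by (simp add: S_def field_simps)
  then show "\<exists>C. \<forall>t>0. \<forall>x. norm (S t x) \<le> C * norm x" by blast
qed (auto simp: S_def intro!: continuous_intros continuous_R)

text \<open>\<open>P_eq\<close> is available for \<open>t > 0\<close> only; since regularity looks
  at no other \<open>t\<close>, agreement there is enough to transfer it.\<close>

lemma regular_cong:
  assumes "regular A" "\<And>t x. t > 0 \<Longrightarrow> A t x = B t x" shows "regular B"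
proof -
  have "continuous_on {0<..} (\<lambda>t. A t x) = continuous_on {0<..} (\<lambda>t. B t x)" for x
    by (rule continuous_on_cong) (auto simp: assms(2))
  moreover have "A t = B t" if "t > 0" for t using assms(2)[OF that] by blast
  ultimately show ?thesis using assms(1) by (simp add: regular_def)
qed

lemma regular_P: "regular P"
  by (rule regular_cong[OF regular_diff[OF regular_add[OF regular_id
        regular_scaleR[OF regular_S, of "2 * c"]] regular_U]])
     (simp add: P_eq)

lemma regular_V: "regular V"
  using regular_add[OF regular_diff[OF regular_U regular_scaleR[OF regular_S, of "4 * c"]]
      regular_scaleR[OF regular_P, of "4 * c\<^sup>2"]]
  by (simp add: V_def[abs_def])

section \<open>Commutation rules and powers of the resolvent\<close>

lemma regular_R_commute:
  assumes A: "regular A" and t: "t > 0" shows "A t (R t x) = R t (A t x)"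
proof -
  let ?y = "A t (R t x)"
  have y: "?y \<in> D" "T ?y = A t (T (R t x))"
    using regular_in_D[OF A t] regular_T[OF A t] R_in_D[OF t] by simp_all
  have Ty: "T ?y \<in> D" "T (T ?y) = A t (T (T (R t x)))"
    unfolding y(2)
    by (rule regular_in_D[OF A t TR_in_D[OF t]]) (rule regular_T[OF A t TR_in_D[OF t]])
  \<comment> \<open>\<open>A t\<close> commutes with Q on its domain, so \<open>?y\<close> solves Q
    y = A x; the left inverse makes this solution unique.\<close>
  have "T (T ?y) - (2 * t * c) *\<^sub>R T ?y + t\<^sup>2 *\<^sub>R ?y =
      A t (T (T (R t x)) - (2 * t * c) *\<^sub>R T (R t x) + t\<^sup>2 *\<^sub>R R t x)"
    by (simp add: y(2) regular_T[OF A t TR_in_D[OF t]] linear_add[OF regular_linear[OF A t]]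
        linear_diff[OF regular_linear[OF A t]] linear_scale[OF regular_linear[OF A t]])
  also have "\<dots> = A t x" using right_inverse[OF t, of x] by simp
  finally show ?thesis using left_inverse[OF t y(1) Ty(1)] by simp
qed

lemma regular_U_commute:
  assumes A: "regular A" and t: "t > 0" shows "A t (U t x) = U t (A t x)"
  by (simp add: U_def linear_scale[OF regular_linear[OF A t]] regular_R_commute[OF A t])

lemma regular_P_commute:
  assumes A: "regular A" and t: "t > 0" shows "A t (P t x) = P t (A t x)"
proof -
  have "P t (A t x) = T (T (A t (R t x)))"
    by (simp only: P_def regular_R_commute[OF A t])
  also have "\<dots> = T (A t (T (R t x)))"
    by (simp only: regular_T[OF A t R_in_D[OF t]])
  also have "\<dots> = A t (P t x)"
    unfolding P_def by (rule regular_T[OF A t TR_in_D[OF t]])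
  finally show ?thesis ..
qed

lemma regular_power_dom:
  assumes A: "regular A" and t: "t > 0" and x: "x \<in> power_dom D T k"
  shows "A t x \<in> power_dom D T k \<and> (T ^^ k) (A t x) = A t ((T ^^ k) x)"
  using x
proof (induction k)
  case (Suc k)
  then show ?case using regular_in_D[OF A t] regular_T[OF A t] by simp
qed simp

lemma R_power_dom:
  assumes t: "t > 0" and x: "x \<in> power_dom D T k"
  shows "R t x \<in> power_dom D T (k + 1)" "(T ^^ (k + 1)) (R t x) = T (R t ((T ^^ k) x))"
    and "R t x \<in> power_dom D T (k + 2)" "(T ^^ (k + 2)) (R t x) = P t ((T ^^ k) x)"
proof -
  have *: "R t x \<in> power_dom D T k \<and> (T ^^ k) (R t x) = R t ((T ^^ k) x)"
    using x
  proof (induction k)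
    case (Suc k)
    then show ?case using R_in_D[OF t] TR_commute[OF t] by simp
  qed simp
  then show "R t x \<in> power_dom D T (k + 1)" "(T ^^ (k + 1)) (R t x) = T (R t ((T ^^ k) x))"
    "R t x \<in> power_dom D T (k + 2)" "(T ^^ (k + 2)) (R t x) = P t ((T ^^ k) x)"
    using R_in_D[OF t] TR_in_D[OF t] by (simp_all add: P_def)
qed

text \<open>Each further resolvent absorbs one more T^2, which turns into a factor
  \<open>P t\<close>. These are the terms of \<open>psi\<close> in which the power of
  \<open>T\<close> is even.\<close>

lemma R_funpow:
  assumes t: "t > 0"
  shows "(R t ^^ m) x \<in> power_dom D T (2 * m)"
    and "(T ^^ (2 * m)) ((R t ^^ m) x) = (P t ^^ m) x"
proof (induction m)
  case (Suc m)
  { case 1 show ?case using R_power_dom(3)[OF t Suc(1)] by simp }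
  { case 2 show ?case using R_power_dom(4)[OF t Suc(1)] Suc(2) by simp }
qed simp_all

text \<open>There is one factor \<open>T\<close> fewer than the resolvents can absorb, so one of
  them is left as T R instead of P. This is the second term of \<open>psi\<close> for odd
  \<open>n\<close>.\<close>

lemma R_funpow_odd:
  assumes t: "t > 0"
  shows "(R t ^^ Suc m) x \<in> power_dom D T (2 * m + 1)"
    and "(T ^^ (2 * m + 1)) ((R t ^^ Suc m) x) = T (R t ((P t ^^ m) x))"
  using R_power_dom(1,2)[OF t R_funpow(1)[OF t]] R_funpow(2)[OF t] by simp_all

lemma T_funpow_scaleR:
  assumes "x \<in> power_dom D T k"
  shows "r *\<^sub>R x \<in> power_dom D T k \<and> (T ^^ k) (r *\<^sub>R x) = r *\<^sub>R (T ^^ k) x"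
  using assms by (induction k) (auto simp: T_scaleR D_closed)

lemma U_funpow: "t > 0 \<Longrightarrow> (U t ^^ m) x = t ^ (2 * m) *\<^sub>R (R t ^^ m) x"
  by (induction m) (simp_all add: U_def linear_scale[OF linear_R] power2_eq_square)

section \<open>Factorisation of the powers of I - P^m\<close>

lemma W_W: assumes t: "t > 0" shows "W t (W t x) = V t (U t x)"
proof -
  note lin = linear_add[OF regular_linear[OF _ t]] linear_diff[OF regular_linear[OF _ t]]
    linear_scale[OF regular_linear[OF _ t]]
  have W: "W t y = U t y - (2 * c) *\<^sub>R S t y" for y
    using P_eq[OF t, of y] by (simp add: W_def)
  \<comment> \<open>Both sides are t^2 T^2 R^2 x. Trading S^2 for P U is what lets a factor
    \<open>U\<close> be taken out of all three terms of the square.\<close>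
  have SS: "S t (S t x) = P t (U t x)"
  proof -
    have "S t (S t x) = t\<^sup>2 *\<^sub>R T (R t (T (R t x)))"
      using t by (simp add: S_def linear_scale[OF linear_R] T_scaleR R_in_D power2_eq_square)
    also have "\<dots> = t\<^sup>2 *\<^sub>R P t (R t x)"
      by (simp add: P_def TR_commute[OF t] R_in_D[OF t])
    also have "\<dots> = P t (U t x)"
      by (simp add: U_def linear_scale[OF regular_linear[OF regular_P t]])
    finally show ?thesis .
  qed
  have "W t (W t x) = U t (U t x) - (2 * c) *\<^sub>R U t (S t x)
      - (2 * c) *\<^sub>R (S t (U t x) - (2 * c) *\<^sub>R S t (S t x))"
    by (simp add: W lin[OF regular_U] lin[OF regular_S])
  also have "U t (S t x) = S t (U t x)"
    by (rule regular_U_commute[OF regular_S t, symmetric])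
  finally show ?thesis
    unfolding V_def SS by (simp add: algebra_simps power2_eq_square scaleR_2[symmetric])
qed

lemma W_funpow: "t > 0 \<Longrightarrow> (W t ^^ (2 * m)) x = (V t ^^ m) ((U t ^^ m) x)"
proof (induction m arbitrary: x)
  case (Suc m)
  have "(W t ^^ (2 * Suc m)) x = W t (W t ((W t ^^ (2 * m)) x))" by simp
  also have "\<dots> = V t (U t ((V t ^^ m) ((U t ^^ m) x)))"
    using Suc by (simp add: W_W)
  also have "U t ((V t ^^ m) ((U t ^^ m) x)) = (V t ^^ m) (U t ((U t ^^ m) x))"
    using regular_U_commute[OF regular_funpow[OF regular_V] Suc.prems] by simp
  finally show ?case by simp
qed simp

text \<open>\<open>G m = I + P + \<dots> + P^(m-1)\<close>, the cofactor in \<open>I - P^m = W (G m)\<close>.\<close>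

primrec G :: "nat \<Rightarrow> real \<Rightarrow> 'a \<Rightarrow> 'a" where
  "G 0 = (\<lambda>t x. 0)"
| "G (Suc m) = (\<lambda>t x. x + P t (G m t x))"

lemma regular_G: "regular (G m)"
proof (induction m)
  case 0
  then show ?case using regular_scaleR[OF regular_id, of 0] by simp
next
  case (Suc m)
  then show ?case using regular_add[OF regular_id regular_compose[OF regular_P Suc]] by simp
qed

lemma W_G: assumes t: "t > 0" shows "W t (G m t x) = x - (P t ^^ m) x"
proof (induction m)
  case 0
  then show ?case using linear_0[OF regular_linear[OF regular_P t]] by (simp add: W_def)
next
  case (Suc m)
  have "W t (G (Suc m) t x) = x - P t x + (P t (G m t x) - P t (P t (G m t x)))"
    by (simp add: W_def linear_add[OF regular_linear[OF regular_P t]])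
  also have "P t (G m t x) - P t (P t (G m t x)) = P t (W t (G m t x))"
    by (simp add: W_def linear_diff[OF regular_linear[OF regular_P t]])
  also have "\<dots> = P t x - P t ((P t ^^ m) x)"
    by (simp add: Suc linear_diff[OF regular_linear[OF regular_P t]])
  finally show ?case by simp
qed

definition B :: "nat \<Rightarrow> real \<Rightarrow> 'a \<Rightarrow> 'a" where "B m t x = x - (P t ^^ m) x"

lemma regular_B: "regular (B m)"
  using regular_diff[OF regular_id regular_funpow[OF regular_P, of m]] by (simp add: B_def[abs_def])

text \<open>\<open>B m\<close> is the product of the commuting families \<open>W\<close> and
  \<open>G m\<close>, so its powers split. The exponent is \<open>2 * m\<close> because two factors
  \<open>W\<close> produce one \<open>U\<close>, and \<open>m\<close> factors \<open>U\<close> reach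
  the domain of T^(2m).\<close>

lemma B_funpow_factor:
  assumes t: "t > 0"
  shows "(B m t ^^ (2 * m)) x = (V t ^^ m) ((U t ^^ m) ((G m t ^^ (2 * m)) x))"
proof -
  have P_G: "P t (G m t y) = G m t (P t y)" for y
    by (rule regular_P_commute[OF regular_G t, symmetric])
  have W_G': "W t (G m t y) = G m t (W t y)" for y
    by (simp add: W_def P_G linear_diff[OF regular_linear[OF regular_G t]])
  have "(B m t ^^ k) x = (W t ^^ k) ((G m t ^^ k) x)" for k
  proof (induction k)
    case (Suc k)
    have "(G m t) ((W t ^^ j) y) = (W t ^^ j) (G m t y)" for j y
      by (induction j) (simp_all add: W_G'[symmetric])
    then show ?case
      using Suc by (simp add: B_def W_G[OF t, symmetric])
  qed simp
  then show ?thesis by (simp add: W_funpow[OF t])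
qed

text \<open>From B = I - P^m one gets I - B^(k+1) = (I - B^k) + B^k P^m, so a factor P^m collects on
  the right and the rest stays uniformly bounded.\<close>

lemma B_funpow_diff_bound:
  "\<exists>C>0. \<forall>t>0. \<forall>x. norm (x - (B m t ^^ k) x) \<le> C * norm ((P t ^^ m) x)"
proof (induction k)
  case 0
  then show ?case by (auto intro!: exI[of _ 1])
next
  case (Suc k)
  then obtain C where C: "C > 0" "\<And>t x. t > 0 \<Longrightarrow>
      norm (x - (B m t ^^ k) x) \<le> C * norm ((P t ^^ m) x)" by blast
  obtain C' where C': "C' > 0" "\<And>t x. t > 0 \<Longrightarrow> norm ((B m t ^^ k) x) \<le> C' * norm x"
    using regular_bound[OF regular_funpow[OF regular_B]] by blast
  have "norm (x - (B m t ^^ Suc k) x) \<le> (C + C') * norm ((P t ^^ m) x)" if t: "t > 0" for t x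
  proof -
    have "(B m t ^^ Suc k) x = (B m t ^^ k) (x - (P t ^^ m) x)"
      by (simp add: funpow_swap1 B_def)
    also have "\<dots> = (B m t ^^ k) x - (B m t ^^ k) ((P t ^^ m) x)"
      by (rule linear_diff[OF regular_linear[OF regular_funpow[OF regular_B] t]])
    finally have "x - (B m t ^^ Suc k) x = (x - (B m t ^^ k) x) + (B m t ^^ k) ((P t ^^ m) x)"
      by simp
    then have "norm (x - (B m t ^^ Suc k) x) \<le>
        norm (x - (B m t ^^ k) x) + norm ((B m t ^^ k) ((P t ^^ m) x))"
      by (metis norm_triangle_ineq)
    then show ?thesis using C(2)[OF t, of x] C'(2)[OF t, of "(P t ^^ m) x"]
      by (simp add: distrib_right)
  qed
  then show ?case using C(1) C'(1) by (intro exI[of _ "C + C'"]) auto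
qed

section \<open>Estimates relating \<open>\<Psi>\<close> to splittings of a vector\<close>

definition J :: "nat \<Rightarrow> real \<Rightarrow> 'a \<Rightarrow> 'a" where
  "J n t x = (if even n then (P t ^^ (n div 2)) x else S t ((P t ^^ (n div 2)) x))"

lemma regular_J: "regular (J n)"
proof (cases "even n")
  case True
  then show ?thesis using regular_funpow[OF regular_P, of "n div 2"] by (simp add: J_def[abs_def])
next
  case False
  then show ?thesis
    using regular_compose[OF regular_S regular_funpow[OF regular_P, of "n div 2"]]
    by (simp add: J_def[abs_def])
qed

text \<open>With m = (n + 1) div 2, \<open>J n t\<close> is t^(2m-n) T^n R^m in a visibly bounded
  form: the surplus power of t is 0 for even \<open>n\<close> and 1 for odd \<open>n\<close>, where
  it completes T R to \<open>S t\<close>.\<close>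

lemma T_funpow_U_funpow:
  assumes t: "t > 0"
  shows "(U t ^^ ((n + 1) div 2)) x \<in> power_dom D T n"
    and "(T ^^ n) ((U t ^^ ((n + 1) div 2)) x) = t ^ n *\<^sub>R J n t x"
proof -
  define m where "m = (n + 1) div 2"
  have "(R t ^^ m) x \<in> power_dom D T n \<and>
      t ^ (2 * m) *\<^sub>R (T ^^ n) ((R t ^^ m) x) = t ^ n *\<^sub>R J n t x"
  proof (cases "even n")
    case True
    then have "n = 2 * m" by (auto simp: m_def)
    then show ?thesis using R_funpow[OF t] by (simp add: J_def)
  next
    case False
    then obtain k where k: "n = 2 * k + 1" by (metis oddE)
    then have "m = Suc k" "n div 2 = k" by (auto simp: m_def)
    then show ?thesis using R_funpow_odd[OF t, of k x] False k by (simp add: J_def S_def)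
  qed
  then show "(U t ^^ ((n + 1) div 2)) x \<in> power_dom D T n"
    "(T ^^ n) ((U t ^^ ((n + 1) div 2)) x) = t ^ n *\<^sub>R J n t x"
    using T_funpow_scaleR[of "(R t ^^ m) x" n "t ^ (2 * m)"]
    by (simp_all add: U_funpow[OF t] m_def)
qed

text \<open>For \<open>b\<close> in the domain of T^n all \<open>n\<close> factors \<open>T\<close>
  can be moved through the resolvents onto \<open>b\<close>; this is the source of the gain
  t^(-n).\<close>

lemma J_power_dom:
  assumes t: "t > 0" and b: "b \<in> power_dom D T n"
  shows "t ^ n *\<^sub>R J n t b = (U t ^^ ((n + 1) div 2)) ((T ^^ n) b)"
  using T_funpow_U_funpow(2)[OF t, of n b]
    regular_power_dom[OF regular_funpow[OF regular_U] t b] by simp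

text \<open>Here T^(n+1) occurs, but \<open>b\<close> can take only \<open>n\<close> factors
  \<open>T\<close>. The remaining one is paired with a resolvent to form \<open>S t\<close>, which
  leaves one factor \<open>U\<close> fewer.\<close>

lemma P_funpow_power_dom_odd:
  assumes t: "t > 0" and b: "b \<in> power_dom D T n" and n: "odd n"
  shows "t ^ n *\<^sub>R (P t ^^ ((n + 1) div 2)) b = S t ((U t ^^ (n div 2)) ((T ^^ n) b))"
proof -
  obtain k where k: "n = 2 * k + 1" using n by (metis oddE)
  let ?y = "(R t ^^ Suc k) b"
  have y: "(T ^^ n) ?y = T (R t ((P t ^^ k) b))"
    using R_funpow_odd(2)[OF t, of k b] by (simp add: k)
  have U: "(T ^^ n) ((U t ^^ Suc k) b) = (U t ^^ Suc k) ((T ^^ n) b)"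
    using regular_power_dom[OF regular_funpow[OF regular_U] t b] by blast
  have "?y \<in> power_dom D T n" using R_funpow_odd(1)[OF t, of k b] by (simp add: k)
  then have "(T ^^ n) ((U t ^^ Suc k) b) = t ^ (2 * Suc k) *\<^sub>R T (R t ((P t ^^ k) b))"
    using T_funpow_scaleR[of ?y n "t ^ (2 * Suc k)"] y U_funpow[OF t] by metis
  with U have "t ^ (2 * Suc k) *\<^sub>R T (R t ((P t ^^ k) b)) = (U t ^^ Suc k) ((T ^^ n) b)"
    by metis
  \<comment> \<open>The last \<open>T\<close> completes P^(k+1) on the left and turns
    \<open>T (U t y)\<close> into \<open>t *\<^sub>R S t y\<close> on the right. Cancelling one
    \<open>t\<close> leaves t^n, as 2 (k + 1) = n + 1.\<close>
  then have "T (t ^ (2 * Suc k) *\<^sub>R T (R t ((P t ^^ k) b))) = T (U t ((U t ^^ k) ((T ^^ n) b)))"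
    by simp
  then have "t ^ (2 * Suc k) *\<^sub>R (P t ^^ Suc k) b = t *\<^sub>R S t ((U t ^^ k) ((T ^^ n) b))"
    using t by (simp add: T_scaleR R_in_D TR_in_D P_def[symmetric] U_def S_def power2_eq_square
        del: power_Suc)
  then have "t *\<^sub>R (t ^ n *\<^sub>R (P t ^^ Suc k) b) = t *\<^sub>R S t ((U t ^^ k) ((T ^^ n) b))"
    by (simp add: k mult.assoc)
  then have "t ^ n *\<^sub>R (P t ^^ Suc k) b = S t ((U t ^^ k) ((T ^^ n) b))"
    using t scaleR_cancel_left by (metis less_irrefl)
  then show ?thesis by (simp add: k)
qed

text \<open>The function \<open>psi\<close> expressed through the bounded families; the two agree
  for \<open>t > 0\<close>.\<close>

definition \<Psi> :: "nat \<Rightarrow> real \<Rightarrow> 'a \<Rightarrow> real" where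
  "\<Psi> n t x = (if even n then norm (J n t x)
     else norm ((P t ^^ ((n + 1) div 2)) x) + norm (J n t x))"

text \<open>For even \<open>n\<close> the halves \<open>n div 2\<close> and
  \<open>(n + 1) div 2\<close> coincide, so \<open>J\<close> is itself the power of
  \<open>P\<close>, and one set of estimates serves both parities.\<close>

lemma \<Psi>_bounds:
  shows "norm (J n t x) \<le> \<Psi> n t x" "norm ((P t ^^ ((n + 1) div 2)) x) \<le> \<Psi> n t x"
    "\<Psi> n t x \<le> norm ((P t ^^ ((n + 1) div 2)) x) + norm (J n t x)"
  by (auto simp: \<Psi>_def J_def)

lemma continuous_\<Psi>: "continuous_on {0<..} (\<lambda>t. \<Psi> n t x)"
proof -
  note J = continuous_on_norm[OF regular_continuous[OF regular_J, of n x]]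
  note P = continuous_on_norm[OF regular_continuous[OF regular_funpow[OF regular_P],
        of "(n + 1) div 2" x]]
  show ?thesis
    using J continuous_on_add[OF P J] by (cases "even n") (simp_all add: \<Psi>_def)
qed

text \<open>On \<open>a\<close> only the uniform bounds are used; on \<open>b\<close> the powers of
  \<open>T\<close> are first moved onto \<open>b\<close>, which produces the factor t^(-n).\<close>

lemma \<Psi>_upper:
  obtains C where "C > 0" "\<And>t a b. t > 0 \<Longrightarrow> b \<in> power_dom D T n \<Longrightarrow>
    \<Psi> n t (a + b) \<le> C * (norm a + norm ((T ^^ n) b) / t ^ n)"
proof -
  let ?m = "(n + 1) div 2"
  obtain C1 where C1: "C1 > 0" "\<And>t x. t > 0 \<Longrightarrow> norm ((P t ^^ ?m) x) \<le> C1 * norm x"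
    using regular_bound[OF regular_funpow[OF regular_P]] by blast
  obtain C2 where C2: "C2 > 0" "\<And>t x. t > 0 \<Longrightarrow> norm (J n t x) \<le> C2 * norm x"
    using regular_bound[OF regular_J] by blast
  obtain C3 where C3: "C3 > 0" "\<And>t x. t > 0 \<Longrightarrow> norm ((U t ^^ ?m) x) \<le> C3 * norm x"
    using regular_bound[OF regular_funpow[OF regular_U]] by blast
  obtain C4 where C4: "C4 > 0" "\<And>t x. t > 0 \<Longrightarrow> norm (S t ((U t ^^ (n div 2)) x)) \<le> C4 * norm x"
    using regular_bound[OF regular_compose[OF regular_S regular_funpow[OF regular_U]]] by blast
  have *: "norm y \<le> norm z / t ^ n" if "t > 0" "t ^ n *\<^sub>R y = z" for t :: real and y z :: 'a
    using that by (auto simp: field_simps)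
  have "\<Psi> n t (a + b) \<le> (C1 + C2 + (C3 + C4)) * (norm a + norm ((T ^^ n) b) / t ^ n)"
    if t: "t > 0" and b: "b \<in> power_dom D T n" for t a b
  proof -
    let ?N = "norm ((T ^^ n) b) / t ^ n"
    have Jb: "norm (J n t b) \<le> C3 * ?N"
      using order_trans[OF *[OF t J_power_dom[OF t b]] divide_right_mono[OF C3(2)[OF t]]] t by simp
    have Pb: "norm ((P t ^^ ?m) b) \<le> C4 * ?N" if "odd n"
      using order_trans[OF *[OF t P_funpow_power_dom_odd[OF t b that]]
          divide_right_mono[OF C4(2)[OF t]]] t by simp
    have J: "norm (J n t (a + b)) \<le> C2 * norm a + C3 * ?N"
      using norm_triangle_ineq[of "J n t a" "J n t b"] Jb C2(2)[OF t, of a]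
      by (simp add: linear_add[OF regular_linear[OF regular_J t]])
    have P: "norm ((P t ^^ ?m) (a + b)) \<le> C1 * norm a + C4 * ?N" if "odd n"
      using norm_triangle_ineq[of "(P t ^^ ?m) a" "(P t ^^ ?m) b"] Pb[OF that] C1(2)[OF t, of a]
      by (simp add: linear_add[OF regular_linear[OF regular_funpow[OF regular_P] t]])
    have "\<Psi> n t (a + b) \<le> (C1 + C2) * norm a + (C3 + C4) * ?N"
    proof -
      have "0 \<le> C1 * norm a" "0 \<le> C4 * ?N" using C1(1) C4(1) t by simp_all
      then show ?thesis using J P by (cases "even n") (simp_all add: \<Psi>_def distrib_right add_divide_distrib)
    qed
    also have "\<dots> \<le> (C1 + C2 + (C3 + C4)) * norm a + (C1 + C2 + (C3 + C4)) * ?N"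
      using C1(1) C2(1) C3(1) C4(1) t
      by (intro add_mono[OF mult_right_mono mult_right_mono]) auto
    finally show ?thesis by (simp add: distrib_left)
  qed
  then show thesis using that[of "C1 + C2 + (C3 + C4)"] C1(1) C2(1) C3(1) C4(1) by simp
qed

lemma \<Psi>_lower:
  obtains C where "C > 0" "\<And>t x. t > 0 \<Longrightarrow> \<exists>b\<in>power_dom D T n.
    norm (x - b) \<le> C * \<Psi> n t x \<and> norm b \<le> C * norm x \<and> norm ((T ^^ n) b) / t ^ n \<le> C * \<Psi> n t x"
proof -
  let ?m = "(n + 1) div 2"
  obtain C1 where C1: "C1 > 0" "\<And>t x. t > 0 \<Longrightarrow>
      norm (x - (B ?m t ^^ (2 * ?m)) x) \<le> C1 * norm ((P t ^^ ?m) x)"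
    using B_funpow_diff_bound by blast
  \<comment> \<open>The graph norm contains \<open>norm b\<close> besides the top power of
    \<open>T\<close>, so \<open>b\<close> itself must be controlled by \<open>x\<close>.\<close>
  obtain C2 where C2: "C2 > 0" "\<And>t x. t > 0 \<Longrightarrow> norm ((B ?m t ^^ (2 * ?m)) x) \<le> C2 * norm x"
    using regular_bound[OF regular_funpow[OF regular_B]] by blast
  \<comment> \<open>What remains of B^(2m) once U^m is split off. On U^m x the power T^n gives t^n
    \<open>J n t x\<close>, and regularity of \<open>H\<close> lets T^n pass through it.\<close>
  define H where "H t x = (V t ^^ ?m) ((G ?m t ^^ (2 * ?m)) x)" for t x
  have H: "regular H"
    using regular_compose[OF regular_funpow[OF regular_V] regular_funpow[OF regular_G]]
    by (simp add: H_def[abs_def])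
  obtain C3 where C3: "C3 > 0" "\<And>t x. t > 0 \<Longrightarrow> norm (H t x) \<le> C3 * norm x"
    using regular_bound[OF H] by blast
  let ?C = "C1 + C2 + C3"
  have "\<exists>b\<in>power_dom D T n. norm (x - b) \<le> ?C * \<Psi> n t x \<and> norm b \<le> ?C * norm x \<and>
      norm ((T ^^ n) b) / t ^ n \<le> ?C * \<Psi> n t x" if t: "t > 0" for t x
  proof (intro bexI conjI)
    let ?b = "(B ?m t ^^ (2 * ?m)) x"
    have comm: "(U t ^^ k) ((G ?m t ^^ (2 * ?m)) x) = (G ?m t ^^ (2 * ?m)) ((U t ^^ k) x)" for k
      by (induction k) (simp_all add: regular_U_commute[OF regular_funpow[OF regular_G] t])
    have b: "?b = H t ((U t ^^ ?m) x)"
      unfolding B_funpow_factor[OF t] H_def comm ..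
    have Tb: "?b \<in> power_dom D T n \<and> (T ^^ n) ?b = t ^ n *\<^sub>R H t (J n t x)"
      unfolding b
      using regular_power_dom[OF H t T_funpow_U_funpow(1)[OF t, of n x]]
        T_funpow_U_funpow(2)[OF t, of n x] linear_scale[OF regular_linear[OF H t]] by simp
    then show "?b \<in> power_dom D T n" by blast
    have nn: "0 \<le> \<Psi> n t x" using order_trans[OF norm_ge_zero \<Psi>_bounds(1)] .
    have "norm ((T ^^ n) ?b) / t ^ n = norm (H t (J n t x))" using Tb t by simp
    also have "\<dots> \<le> C3 * norm (J n t x)" using C3(2)[OF t] .
    also have "\<dots> \<le> ?C * \<Psi> n t x"
      using C1(1) C2(1) C3(1) nn by (intro mult_mono \<Psi>_bounds) auto
    finally show "norm ((T ^^ n) ?b) / t ^ n \<le> ?C * \<Psi> n t x" .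
    have "norm (x - ?b) \<le> C1 * norm ((P t ^^ ?m) x)" using C1(2)[OF t] .
    also have "\<dots> \<le> ?C * \<Psi> n t x"
      using C1(1) C2(1) C3(1) nn by (intro mult_mono \<Psi>_bounds) auto
    finally show "norm (x - ?b) \<le> ?C * \<Psi> n t x" .
    have "norm ?b \<le> C2 * norm x" using C2(2)[OF t] .
    also have "\<dots> \<le> ?C * norm x" using C1(1) C3(1) by (intro mult_right_mono) auto
    finally show "norm ?b \<le> ?C * norm x" .
  qed
  then show thesis using that[of ?C] C1(1) C2(1) C3(1) by simp
qed

end

section \<open>The spaces \<open>L\<^sup>p\<close> and the measure \<open>dt/t\<close>\<close>

lemma Lp_norm_nonneg: "0 \<le> Lp_norm p M f"
  by (simp add: Lp_norm_def)

lemma in_Lp_measurable: "in_Lp p M f \<Longrightarrow> f \<in> borel_measurable M"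
  by (simp add: in_Lp_def)

lemma enn2real_ge_1: "1 \<le> p \<Longrightarrow> p \<noteq> \<infinity> \<Longrightarrow> 1 \<le> enn2real p"
  using enn2real_mono[of 1 p] by (simp add: top.not_eq_extremum)

text \<open>The lattice property of L^p with a constant; congruence, scaling and sums below are
  deduced from it.\<close>

lemma Lp_mono:
  assumes f: "f \<in> borel_measurable M" and g: "in_Lp p M g" and p: "1 \<le> p" and C: "0 \<le> C"
    and le: "\<And>x. x \<in> space M \<Longrightarrow> \<bar>f x\<bar> \<le> C * \<bar>g x\<bar>"
  shows "in_Lp p M f" "Lp_norm p M f \<le> C * Lp_norm p M g"
proof -
  have "in_Lp p M f \<and> Lp_norm p M f \<le> C * Lp_norm p M g"
  proof (cases "p = \<infinity>")
    case True
    let ?e = "esssup M (\<lambda>t. ennreal \<bar>g t\<bar>)"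
    have fin: "?e < \<infinity>" using g True by (simp add: in_Lp_def)
    have "AE x in M. ennreal \<bar>g x\<bar> \<le> ?e" by (rule esssup_AE)
    then have "AE x in M. ennreal \<bar>f x\<bar> \<le> ennreal C * ?e"
    proof (rule AE_mp, intro AE_I2 impI)
      fix x assume "x \<in> space M" "ennreal \<bar>g x\<bar> \<le> ?e"
      have "ennreal \<bar>f x\<bar> \<le> ennreal (C * \<bar>g x\<bar>)"
        by (rule ennreal_leI[OF le]) fact
      also have "\<dots> = ennreal C * ennreal \<bar>g x\<bar>"
        by (rule ennreal_mult[OF C]) simp
      also have "\<dots> \<le> ennreal C * ?e"
        by (rule mult_left_mono) (fact, simp)
      finally show "ennreal \<bar>f x\<bar> \<le> ennreal C * ?e" .
    qed
    then have *: "esssup M (\<lambda>t. ennreal \<bar>f t\<bar>) \<le> ennreal C * ?e"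
      using f by (intro esssup_I) auto
    have fin': "ennreal C * ?e < \<infinity>" using fin by (simp add: ennreal_mult_less_top)
    have "enn2real (esssup M (\<lambda>t. ennreal \<bar>f t\<bar>)) \<le> C * enn2real ?e"
      using enn2real_mono[OF *] fin' C by (simp add: enn2real_mult)
    then show ?thesis
      using f True le_less_trans[OF * fin'] by (simp add: in_Lp_def Lp_norm_def)
  next
    case False
    define q where "q = enn2real p"
    have q: "1 \<le> q" using enn2real_ge_1[OF p False] by (simp add: q_def)
    have gi: "integrable M (\<lambda>t. \<bar>g t\<bar> powr q)" using g False by (simp add: in_Lp_def q_def)
    have le': "\<bar>f x\<bar> powr q \<le> C powr q * \<bar>g x\<bar> powr q" if "x \<in> space M" for x
      using powr_mono2[of q "\<bar>f x\<bar>" "C * \<bar>g x\<bar>"] le[OF that] q C by (simp add: powr_mult)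
    have fi: "integrable M (\<lambda>t. \<bar>f t\<bar> powr q)"
      by (rule Bochner_Integration.integrable_bound[OF integrable_mult_right[OF gi, of "C powr q"]])
         (use f le' in auto)
    have "(LINT t|M. \<bar>f t\<bar> powr q) \<le> (LINT t|M. C powr q * \<bar>g t\<bar> powr q)"
      using fi gi le' by (intro integral_mono) auto
    then have "(LINT t|M. \<bar>f t\<bar> powr q) powr (1 / q) \<le> (C powr q * (LINT t|M. \<bar>g t\<bar> powr q)) powr (1 / q)"
      using q by (intro powr_mono2) auto
    also have "\<dots> = C * (LINT t|M. \<bar>g t\<bar> powr q) powr (1 / q)"
      using q C by (simp add: powr_mult powr_powr)
    finally show ?thesis
      using f fi False by (simp add: in_Lp_def Lp_norm_def q_def)
  qed
  then show "in_Lp p M f" "Lp_norm p M f \<le> C * Lp_norm p M g" by auto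
qed

text \<open>Domination with constant 1 in both directions. Under \<open>haar_pos\<close> it allows
  the exchange of formulas that agree just for \<open>t > 0\<close>.\<close>

lemma Lp_cong:
  assumes p: "1 \<le> p" and eq: "\<And>x. x \<in> space M \<Longrightarrow> f x = g x"
  shows "in_Lp p M f \<longleftrightarrow> in_Lp p M g"
    and "in_Lp p M g \<Longrightarrow> Lp_norm p M f = Lp_norm p M g"
proof -
  have meas: "f \<in> borel_measurable M \<longleftrightarrow> g \<in> borel_measurable M"
    by (rule measurable_cong) fact
  have le: "\<bar>f x\<bar> \<le> 1 * \<bar>g x\<bar>" "\<bar>g x\<bar> \<le> 1 * \<bar>f x\<bar>" if "x \<in> space M" for x
    using eq[OF that] by simp_all
  show iff: "in_Lp p M f \<longleftrightarrow> in_Lp p M g"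
  proof
    assume f: "in_Lp p M f"
    show "in_Lp p M g"
      by (rule Lp_mono(1)[OF _ f p zero_le_one le(2)]) (use meas in_Lp_measurable[OF f] in auto)
  next
    assume g: "in_Lp p M g"
    show "in_Lp p M f"
      by (rule Lp_mono(1)[OF _ g p zero_le_one le(1)]) (use meas in_Lp_measurable[OF g] in auto)
  qed
  assume g: "in_Lp p M g"
  then have f: "in_Lp p M f" using iff by simp
  show "Lp_norm p M f = Lp_norm p M g"
    using Lp_mono(2)[OF in_Lp_measurable[OF f] g p zero_le_one le(1)]
      Lp_mono(2)[OF in_Lp_measurable[OF g] f p zero_le_one le(2)] by simp
qed

lemma in_Lp_scale: "1 \<le> p \<Longrightarrow> in_Lp p M f \<Longrightarrow> in_Lp p M (\<lambda>x. c * f x)"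
  by (rule Lp_mono(1)[where C = "\<bar>c\<bar>" and g = f])
     (simp_all add: abs_mult in_Lp_measurable borel_measurable_times)

lemma Lp_norm_scale: assumes p: "1 \<le> p" and f: "in_Lp p M f"
  shows "Lp_norm p M (\<lambda>x. c * f x) = \<bar>c\<bar> * Lp_norm p M f"
proof (rule antisym)
  note fm = in_Lp_measurable[OF f]
  show "Lp_norm p M (\<lambda>x. c * f x) \<le> \<bar>c\<bar> * Lp_norm p M f"
    by (rule Lp_mono(2)[OF _ f p]) (simp_all add: abs_mult fm borel_measurable_times)
  show "\<bar>c\<bar> * Lp_norm p M f \<le> Lp_norm p M (\<lambda>x. c * f x)"
  proof (cases "c = 0")
    case False
    have "Lp_norm p M f \<le> (1 / \<bar>c\<bar>) * Lp_norm p M (\<lambda>x. c * f x)"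
      by (rule Lp_mono(2)[OF fm in_Lp_scale[OF p f] p]) (use False in \<open>simp_all add: abs_mult\<close>)
    then show ?thesis using False by (simp add: field_simps)
  qed (simp add: Lp_norm_nonneg)
qed

text \<open>A triangle inequality up to the constant \<open>4\<close> avoids Minkowski's inequality.\<close>

lemma Lp_add:
  assumes p: "1 \<le> p" and f: "in_Lp p M f" and g: "in_Lp p M g"
  shows "in_Lp p M (\<lambda>x. f x + g x)"
    and "Lp_norm p M (\<lambda>x. f x + g x) \<le> 4 * (Lp_norm p M f + Lp_norm p M g)"
proof -
  \<comment> \<open>The q-th power of the maximum is at most the sum of the q-th powers, and |f + g|
    is at most twice the maximum. Each of the two steps costs a factor 2.\<close>
  define m where "m x = max \<bar>f x\<bar> \<bar>g x\<bar>" for x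
  have [measurable]: "f \<in> borel_measurable M" "g \<in> borel_measurable M"
    using f g by (auto dest: in_Lp_measurable)
  have m_meas: "m \<in> borel_measurable M" unfolding m_def by measurable
  have m: "in_Lp p M m \<and> Lp_norm p M m \<le> 2 * (Lp_norm p M f + Lp_norm p M g)"
  proof (cases "p = \<infinity>")
    case True
    let ?e = "\<lambda>f. esssup M (\<lambda>t. ennreal \<bar>f t\<bar>)"
    have fin: "?e f < \<infinity>" "?e g < \<infinity>" using f g True by (auto simp: in_Lp_def)
    have "AE x in M. ennreal \<bar>f x\<bar> \<le> ?e f" "AE x in M. ennreal \<bar>g x\<bar> \<le> ?e g"
      by (rule esssup_AE)+
    then have "AE x in M. ennreal \<bar>m x\<bar> \<le> ?e f + ?e g"
    proof eventually_elim
      case (elim x)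
      then show ?case
        unfolding m_def by (cases "\<bar>f x\<bar> \<le> \<bar>g x\<bar>") (auto intro: add_increasing add_increasing2)
    qed
    then have *: "?e m \<le> ?e f + ?e g"
      using m_meas by (intro esssup_I) auto
    have "?e f + ?e g < \<infinity>" using fin by simp
    then have "enn2real (?e m) \<le> enn2real (?e f) + enn2real (?e g)"
      using enn2real_mono[OF *] enn2real_plus fin by simp
    also have "\<dots> \<le> 2 * (enn2real (?e f) + enn2real (?e g))" by simp
    finally show ?thesis
      using True le_less_trans[OF * \<open>?e f + ?e g < \<infinity>\<close>] m_meas
      by (simp add: in_Lp_def Lp_norm_def)
  next
    case False
    define q where "q = enn2real p"
    have q: "1 \<le> q" using enn2real_ge_1[OF p False] by (simp add: q_def)
    define a b where "a = Lp_norm p M f" and "b = Lp_norm p M g"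
    have ab: "0 \<le> a" "0 \<le> b" by (auto simp: a_def b_def Lp_norm_nonneg)
    have fi: "integrable M (\<lambda>t. \<bar>f t\<bar> powr q)" and gi: "integrable M (\<lambda>t. \<bar>g t\<bar> powr q)"
      using f g False by (auto simp: in_Lp_def q_def)
    have le: "\<bar>m x\<bar> powr q \<le> \<bar>f x\<bar> powr q + \<bar>g x\<bar> powr q" for x
      unfolding m_def by (cases "\<bar>f x\<bar> \<le> \<bar>g x\<bar>") (auto simp: max_def)
    have mi: "integrable M (\<lambda>t. \<bar>m t\<bar> powr q)"
      by (rule Bochner_Integration.integrable_bound[OF Bochner_Integration.integrable_add[OF fi gi]])
         (use m_meas le in auto)
    have "(LINT t|M. \<bar>m t\<bar> powr q) \<le> (LINT t|M. \<bar>f t\<bar> powr q + \<bar>g t\<bar> powr q)"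
      using mi fi gi le by (intro integral_mono) auto
    also have "\<dots> = a powr q + b powr q"
      using fi gi q False by (simp add: a_def b_def Lp_norm_def q_def[symmetric] powr_powr)
    also have "\<dots> \<le> (a + b) powr q + (a + b) powr q"
      using ab q by (intro add_mono powr_mono2) auto
    also have "\<dots> \<le> 2 powr q * (a + b) powr q"
    proof -
      have "2 powr 1 \<le> 2 powr q" using q by (intro powr_mono) auto
      then show ?thesis using mult_right_mono[of 2 "2 powr q" "(a + b) powr q"] by simp
    qed
    also have "\<dots> = (2 * (a + b)) powr q" using ab powr_mult[of 2 "a + b" q] by simp
    finally have "(LINT t|M. \<bar>m t\<bar> powr q) powr (1 / q) \<le> ((2 * (a + b)) powr q) powr (1 / q)"
      using q by (intro powr_mono2) auto
    also have "\<dots> = 2 * (a + b)" using q ab by (simp add: powr_powr)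
    finally show ?thesis
      using mi False m_meas by (simp add: in_Lp_def Lp_norm_def q_def a_def b_def)
  qed
  have le: "\<bar>f x + g x\<bar> \<le> 2 * \<bar>m x\<bar>" for x by (auto simp: m_def)
  show "in_Lp p M (\<lambda>x. f x + g x)"
    using m by (intro Lp_mono(1)[OF _ _ p _ le]) auto
  have "Lp_norm p M (\<lambda>x. f x + g x) \<le> 2 * Lp_norm p M m"
    using m by (intro Lp_mono(2)[OF _ _ p _ le]) auto
  then show "Lp_norm p M (\<lambda>x. f x + g x) \<le> 4 * (Lp_norm p M f + Lp_norm p M g)"
    using m by simp
qed

text \<open>A zero norm would make \<open>f\<close> vanish almost everywhere. The purpose is to
  divide by the norm of the weight in the comparison of norms.\<close>

lemma Lp_norm_pos:
  assumes p: "1 \<le> p" and f: "in_Lp p M f" and nz: "\<And>x. x \<in> space M \<Longrightarrow> f x \<noteq> 0"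
    and M: "emeasure M (space M) \<noteq> 0"
  shows "0 < Lp_norm p M f"
proof (rule ccontr)
  assume "\<not> 0 < Lp_norm p M f"
  then have 0: "Lp_norm p M f = 0" using Lp_norm_nonneg[of p M f] by simp
  have "AE x in M. f x = 0"
  proof (cases "p = \<infinity>")
    case True
    then have "esssup M (\<lambda>t. ennreal \<bar>f t\<bar>) = 0"
      using 0 f by (auto simp: Lp_norm_def in_Lp_def enn2real_eq_0_iff)
    then have "AE x in M. ennreal \<bar>f x\<bar> \<le> 0"
      using esssup_AE[of "\<lambda>t. ennreal \<bar>f t\<bar>" M] by simp
    then show ?thesis by (simp add: ennreal_eq_0_iff)
  next
    case False
    then have "integrable M (\<lambda>t. \<bar>f t\<bar> powr enn2real p)" "(LINT t|M. \<bar>f t\<bar> powr enn2real p) = 0"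
      using 0 f enn2real_ge_1[OF p False] by (auto simp: Lp_norm_def in_Lp_def)
    then have "AE x in M. \<bar>f x\<bar> powr enn2real p = 0"
      by (subst integral_nonneg_eq_0_iff_AE[symmetric]) auto
    then show ?thesis by simp
  qed
  then have "AE x in M. False" using nz by (auto elim!: AE_mp)
  then show False using M by (simp add: AE_iff_measurable[OF sets.top])
qed

section \<open>Image measures and constant densities\<close>

lemma Lp_distr:
  assumes \<phi>: "\<phi> \<in> measurable M N" and f: "f \<in> borel_measurable N"
  shows "in_Lp p (distr M N \<phi>) f \<longleftrightarrow> in_Lp p M (\<lambda>x. f (\<phi> x))"
    and "Lp_norm p (distr M N \<phi>) f = Lp_norm p M (\<lambda>x. f (\<phi> x))"
proof -
  have f\<phi>: "(\<lambda>x. f (\<phi> x)) \<in> borel_measurable M" using f \<phi> by measurable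
  have "(AE x in distr M N \<phi>. ennreal \<bar>f x\<bar> \<le> z) \<longleftrightarrow> (AE x in M. ennreal \<bar>f (\<phi> x)\<bar> \<le> z)" for z
    using f by (intro AE_distr_iff[OF \<phi>]) measurable
  then have "esssup (distr M N \<phi>) (\<lambda>t. ennreal \<bar>f t\<bar>) = esssup M (\<lambda>t. ennreal \<bar>f (\<phi> t)\<bar>)"
    using f f\<phi> by (simp add: esssup_eq_AE)
  moreover have "(LINT t|distr M N \<phi>. \<bar>f t\<bar> powr enn2real p) = (LINT t|M. \<bar>f (\<phi> t)\<bar> powr enn2real p)"
    using f by (intro integral_distr[OF \<phi>]) auto
  moreover have "integrable (distr M N \<phi>) (\<lambda>t. \<bar>f t\<bar> powr enn2real p)
      \<longleftrightarrow> integrable M (\<lambda>t. \<bar>f (\<phi> t)\<bar> powr enn2real p)"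
    using f by (intro integrable_distr_eq[OF \<phi>]) auto
  ultimately show "in_Lp p (distr M N \<phi>) f \<longleftrightarrow> in_Lp p M (\<lambda>x. f (\<phi> x))"
    "Lp_norm p (distr M N \<phi>) f = Lp_norm p M (\<lambda>x. f (\<phi> x))"
    using f f\<phi> by (simp_all add: in_Lp_def Lp_norm_def)
qed

text \<open>A positive constant density preserves null sets, hence the essential supremum; for
  finite \<open>p\<close> it factors out of the integral and contributes its p-th root.\<close>

lemma Lp_density_const:
  assumes \<kappa>: "\<kappa> > 0" and f: "f \<in> borel_measurable M"
  shows "in_Lp p (density M (\<lambda>_. ennreal \<kappa>)) f \<longleftrightarrow> in_Lp p M f"
    and "Lp_norm p (density M (\<lambda>_. ennreal \<kappa>)) f =
      (if p = \<infinity> then 1 else \<kappa> powr (1 / enn2real p)) * Lp_norm p M f"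
proof -
  have "(AE x in density M (\<lambda>_. ennreal \<kappa>). Q x) \<longleftrightarrow> (AE x in M. Q x)" for Q
    using \<kappa> by (subst AE_density) auto
  then have "esssup (density M (\<lambda>_. ennreal \<kappa>)) (\<lambda>t. ennreal \<bar>f t\<bar>) = esssup M (\<lambda>t. ennreal \<bar>f t\<bar>)"
    using f by (simp add: esssup_eq_AE)
  moreover have "(LINT t|density M (\<lambda>_. ennreal \<kappa>). \<bar>f t\<bar> powr enn2real p) =
      \<kappa> * (LINT t|M. \<bar>f t\<bar> powr enn2real p)"
    using f \<kappa> by (subst integral_density) auto
  moreover have "integrable (density M (\<lambda>_. ennreal \<kappa>)) (\<lambda>t. \<bar>f t\<bar> powr enn2real p) \<longleftrightarrow>
      integrable M (\<lambda>t. \<bar>f t\<bar> powr enn2real p)"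
    using f \<kappa> by (subst integrable_density) auto
  ultimately show "in_Lp p (density M (\<lambda>_. ennreal \<kappa>)) f \<longleftrightarrow> in_Lp p M f"
    "Lp_norm p (density M (\<lambda>_. ennreal \<kappa>)) f =
      (if p = \<infinity> then 1 else \<kappa> powr (1 / enn2real p)) * Lp_norm p M f"
    using f \<kappa> by (simp_all add: in_Lp_def Lp_norm_def powr_mult)
qed

section \<open>The measure dt/t in logarithmic coordinates\<close>

lemma space_haar_pos [simp]: "space haar_pos = {0<..}"
  by (simp add: haar_pos_def space_restrict_space)

lemma sets_haar_pos [measurable_cong]: "sets haar_pos = sets (restrict_space borel {0<..})"
  by (simp add: haar_pos_def sets_restrict_space)

lemma borel_measurable_haar_pos:
  "f \<in> borel_measurable borel \<Longrightarrow> f \<in> borel_measurable haar_pos"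
  by (subst measurable_cong_sets[OF sets_haar_pos refl]) (rule measurable_restrict_space1)

lemma measurable_haar_posI:
  assumes "f \<in> borel_measurable M" "\<And>x. x \<in> space M \<Longrightarrow> 0 < f x"
  shows "f \<in> M \<rightarrow>\<^sub>M haar_pos"
  by (subst measurable_cong_sets[OF refl sets_haar_pos], rule measurable_restrict_space2)
     (use assms in auto)

text \<open>The interval from l to u pulls back to the one from exp l to exp u, whose mass is the
  integral of 1/t over it, that is u - l.\<close>

lemma haar_pos_distr_ln: "distr haar_pos borel ln = lborel"
proof (rule lborel_eqI[symmetric])
  have ln: "ln \<in> haar_pos \<rightarrow>\<^sub>M (borel :: real measure)"
    by (rule borel_measurable_haar_pos) simp
  fix l u :: real assume "\<And>b. b \<in> Basis \<Longrightarrow> l \<bullet> b \<le> u \<bullet> b"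
  then have lu: "l \<le> u" by simp
  let ?I = "{exp l<..<exp u}"
  have I: "x \<in> ln -` box l u \<inter> {0<..} \<longleftrightarrow> x \<in> ?I" for x
  proof (cases "x > 0")
    case True
    then obtain y where "x = exp y" by (metis exp_ln)
    then show ?thesis by (simp add: box_real)
  next
    case False
    then show ?thesis using less_trans[OF exp_gt_zero[of l], of x] by auto
  qed
  then have "ln -` box l u \<inter> {0<..} = ?I" by blast
  then have "emeasure (distr haar_pos borel ln) (box l u) = emeasure haar_pos ?I"
    using ln by (simp add: emeasure_distr)
  also have "\<dots> = (\<integral>\<^sup>+ t. ennreal (1 / t) * indicator ?I t \<partial>restrict_space lborel {0<..})"
    unfolding haar_pos_def
  proof (rule emeasure_density)
    show "(\<lambda>t. ennreal (1 / t)) \<in> borel_measurable (restrict_space lborel {0<..})"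
      by (rule measurable_restrict_space1) simp
    show "?I \<in> sets (restrict_space lborel {0<..})"
      by (subst sets_restrict_space_iff) (auto intro: less_trans[OF exp_gt_zero])
  qed
  also have "\<dots> = (\<integral>\<^sup>+ t. ennreal (1 / t) * indicator ?I t * indicator {0<..} t \<partial>lborel)"
    by (rule nn_integral_restrict_space) simp
  \<comment> \<open>Closing the interval changes a null set and makes the fundamental theorem of
    calculus applicable.\<close>
  also have "\<dots> = (\<integral>\<^sup>+ t. ennreal (1 / t) * indicator {exp l..exp u} t \<partial>lborel)"
  proof (rule nn_integral_cong_AE)
    have "AE t in lborel. t \<noteq> exp l \<and> t \<noteq> exp u" by (simp add: AE_lborel_singleton)
    then show "AE t in lborel. ennreal (1 / t) * indicator ?I t * indicator {0<..} t =
        ennreal (1 / t) * indicator {exp l..exp u} t"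
    proof eventually_elim
      case (elim t)
      then show ?case using less_trans[OF exp_gt_zero, of l t] by (auto simp: indicator_def)
    qed
  qed
  also have "\<dots> = ennreal (ln (exp u) - ln (exp l))"
  proof (rule nn_integral_FTC_Icc)
    fix t assume "t \<in> {exp l..exp u}"
    then have t: "t > 0" by (auto intro: less_le_trans[OF exp_gt_zero])
    show "DERIV ln t :> 1 / t" by (rule DERIV_ln_divide[OF t])
    show "0 \<le> 1 / t" using t by simp
  qed (use lu in auto)
  finally show "emeasure (distr haar_pos borel ln) (box l u) = ennreal (\<Prod>b\<in>Basis. (u - l) \<bullet> b)"
    by simp
qed simp

lemma exp_measurable_haar_pos: "exp \<in> (borel :: real measure) \<rightarrow>\<^sub>M haar_pos"
  by (rule measurable_haar_posI) auto

lemma haar_pos_eq_distr_exp: "haar_pos = distr lborel haar_pos exp"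
proof -
  have "distr lborel haar_pos exp = distr (distr haar_pos borel ln) haar_pos exp"
    by (simp add: haar_pos_distr_ln)
  also have "\<dots> = distr haar_pos haar_pos (exp \<circ> ln)"
    by (rule distr_distr[OF exp_measurable_haar_pos]) (simp add: borel_measurable_haar_pos)
  also have "\<dots> = distr haar_pos haar_pos (\<lambda>t. t)"
    by (rule distr_cong) auto
  also have "\<dots> = haar_pos" by (rule distr_id)
  finally show ?thesis ..
qed

lemma powr_measurable_haar_pos: "(\<lambda>t. t powr a) \<in> haar_pos \<rightarrow>\<^sub>M haar_pos"
  by (rule measurable_haar_posI) (simp_all add: borel_measurable_haar_pos)

text \<open>In the coordinate ln t the power map is multiplication by \<open>a\<close>, under which
  Lebesgue measure is scaled by 1/|a|.\<close>

lemma distr_haar_pos_powr: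
  assumes "a \<noteq> 0"
  shows "distr haar_pos haar_pos (\<lambda>t. t powr a) = density haar_pos (\<lambda>_. ennreal (inverse \<bar>a\<bar>))"
proof -
  have "distr haar_pos haar_pos (\<lambda>t. t powr a) =
      distr (distr lborel haar_pos exp) haar_pos (\<lambda>t. t powr a)"
    using haar_pos_eq_distr_exp by simp
  also have "\<dots> = distr lborel haar_pos ((\<lambda>t. t powr a) \<circ> exp)"
    using exp_measurable_haar_pos by (intro distr_distr powr_measurable_haar_pos) simp
  also have "(\<lambda>t. t powr a) \<circ> exp = exp \<circ> (*) a"
    by (auto simp: powr_def)
  also have "distr lborel haar_pos (exp \<circ> (*) a) = distr (distr lborel borel ((*) a)) haar_pos exp"
    by (rule distr_distr[OF exp_measurable_haar_pos, symmetric]) simp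
  also have "\<dots> = distr (density lborel (\<lambda>_. ennreal (inverse \<bar>a\<bar>))) haar_pos exp"
    by (simp add: lborel_distr_mult[OF assms])
  also have "\<dots> = density (distr lborel haar_pos exp) (\<lambda>_. ennreal (inverse \<bar>a\<bar>))"
    using exp_measurable_haar_pos by (intro density_distr[symmetric]) auto
  finally show ?thesis using haar_pos_eq_distr_exp by simp
qed

lemma Lp_haar_pos_powr:
  assumes a: "a \<noteq> 0" and f: "f \<in> borel_measurable haar_pos"
  shows "in_Lp p haar_pos (\<lambda>t. f (t powr a)) \<longleftrightarrow> in_Lp p haar_pos f"
    and "Lp_norm p haar_pos (\<lambda>t. f (t powr a)) =
      (if p = \<infinity> then 1 else inverse \<bar>a\<bar> powr (1 / enn2real p)) * Lp_norm p haar_pos f"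
  using Lp_distr[OF powr_measurable_haar_pos[of a] f, of p]
    Lp_density_const[OF _ f, of "inverse \<bar>a\<bar>" p] a
  by (simp_all add: distr_haar_pos_powr)

lemma emeasure_haar_pos: "emeasure haar_pos (space haar_pos) \<noteq> 0"
proof -
  have "emeasure (distr lborel haar_pos exp) (space haar_pos) = emeasure lborel (UNIV :: real set)"
    using exp_measurable_haar_pos sets.top[of haar_pos]
    by (subst emeasure_distr) (auto simp: vimage_def)
  then show ?thesis using haar_pos_eq_distr_exp by simp
qed

text \<open>The one-sided exponential plus its reflection dominates the function. An upper bound
  suffices, so the origin may be counted twice.\<close>

lemma integrable_exp_neg_abs:
  assumes d: "d > (0::real)" shows "integrable lborel (\<lambda>y. exp (- d * \<bar>y\<bar>))"
proof -
  have "(\<lambda>y. exp (- d * y)) absolutely_integrable_on {0..}"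
    using has_integral_exp_minus_to_infinity[OF d, of 0]
    by (intro nonnegative_absolutely_integrable_1) (auto simp: integrable_on_def)
  then have 1: "integrable lborel (\<lambda>y. indicator {0..} y * exp (- d * y))"
    by (simp add: set_integrable_def integrable_completion)
  have 2: "integrable lborel (\<lambda>y. indicator {0..} (0 + (- 1) * y) * exp (- d * (0 + (-1) * y)))"
    using lborel_integrable_real_affine[OF 1, of "-1" 0] by simp
  show ?thesis
    by (rule Bochner_Integration.integrable_bound[OF Bochner_Integration.integrable_add[OF 1 2]])
       (auto simp: indicator_def)
qed

text \<open>With s = exp y the function is exp (- \<theta> y) for y \<ge> 0 and exp ((1 - \<theta>)
  y) for y < 0. It decays at both ends because \<theta> lies strictly between 0 and 1.\<close>

lemma in_Lp_powr_min:
  assumes \<theta>: "0 < \<theta>" "\<theta> < 1" and p: "1 \<le> p"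
  shows "in_Lp p haar_pos (\<lambda>s. s powr (- \<theta>) * min 1 s)"
proof -
  define g where "g s = s powr (- \<theta>) * min 1 s" for s :: real
  \<comment> \<open>The slower of the two decay rates.\<close>
  define d where "d = min \<theta> (1 - \<theta>)"
  have d: "d > 0" using \<theta> by (simp add: d_def)
  have g_meas: "g \<in> borel_measurable haar_pos"
    unfolding g_def by (intro borel_measurable_haar_pos borel_measurable_times borel_measurable_min) auto
  have g_exp: "\<bar>g (exp y)\<bar> \<le> exp (- d * \<bar>y\<bar>)" for y
  proof (cases "y \<ge> 0")
    case True
    then have "g (exp y) = exp (- \<theta> * y)" by (simp add: g_def powr_def min_def)
    moreover have "d * y \<le> \<theta> * y" using True by (intro mult_right_mono) (auto simp: d_def)
    ultimately show ?thesis using True by simp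
  next
    case False
    then have "g (exp y) = exp (- \<theta> * y) * exp y" by (simp add: g_def powr_def min_def)
    also have "\<dots> = exp ((1 - \<theta>) * y)" by (simp add: exp_add[symmetric] algebra_simps)
    finally have "g (exp y) = exp ((1 - \<theta>) * y)" .
    moreover have "(1 - \<theta>) * y \<le> d * y" using False by (intro mult_right_mono_neg) (auto simp: d_def)
    ultimately show ?thesis using False by simp
  qed
  have "in_Lp p lborel (\<lambda>y. g (exp y))"
  proof (rule Lp_mono(1)[where g = "\<lambda>y. exp (- d * \<bar>y\<bar>)" and C = 1])
    show "in_Lp p lborel (\<lambda>y. exp (- d * \<bar>y\<bar>))"
    proof (cases "p = \<infinity>")
      case True
      have "esssup lborel (\<lambda>y. ennreal \<bar>exp (- d * \<bar>y\<bar>)\<bar>) \<le> 1"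
        using d by (intro esssup_I AE_I2) auto
      then show ?thesis using True by (auto simp: in_Lp_def intro: le_less_trans)
    next
      case False
      have "integrable lborel (\<lambda>y. exp (- (enn2real p * d) * \<bar>y\<bar>))"
        using enn2real_ge_1[OF p False] d by (intro integrable_exp_neg_abs) simp
      then show ?thesis using False by (simp add: in_Lp_def powr_def mult.assoc)
    qed
    show "(\<lambda>y. g (exp y)) \<in> borel_measurable lborel"
      using measurable_compose[OF exp_measurable_haar_pos g_meas] by simp
  qed (use p g_exp in auto)
  then have "in_Lp p (distr lborel haar_pos exp) g"
    using Lp_distr(1)[OF _ g_meas, of exp lborel p] exp_measurable_haar_pos by simp
  then show ?thesis using haar_pos_eq_distr_exp by (simp add: g_def[abs_def])
qed

section \<open>The K-functional\<close>

lemma K_functional_le: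
  assumes "\<And>b. b \<in> W \<Longrightarrow> 0 \<le> NW b" "0 \<le> t" "b \<in> W"
  shows "K_functional UNIV norm W NW t x \<le> norm (x - b) + t * NW b"
  unfolding K_functional_def
proof (rule cInf_lower)
  show "norm (x - b) + t * NW b \<in> {norm a + t * NW b |a b. a \<in> UNIV \<and> b \<in> W \<and> x = a + b}"
    using assms by (intro CollectI exI[of _ "x - b"] exI[of _ b]) simp
  show "bdd_below {norm a + t * NW b |a b. a \<in> UNIV \<and> b \<in> W \<and> x = a + b}"
    using assms by (intro bdd_belowI[of _ 0]) auto
qed

lemma K_functional_ge:
  assumes "0 \<in> W" "\<And>a b. b \<in> W \<Longrightarrow> x = a + b \<Longrightarrow> c \<le> norm a + t * NW b"
  shows "c \<le> K_functional UNIV norm W NW t x"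
  unfolding K_functional_def
proof (rule cInf_greatest)
  show "{norm a + t * NW b |a b. a \<in> UNIV \<and> b \<in> W \<and> x = a + b} \<noteq> {}"
    using assms(1) by (metis (mono_tags, lifting) UNIV_I add.right_neutral empty_Collect_eq)
qed (use assms(2) in auto)

text \<open>Each splitting costs a nondecreasing function of \<open>t\<close>, so the infimum is
  monotone.\<close>

lemma K_functional_measurable:
  assumes W: "0 \<in> W" and NW: "\<And>b. b \<in> W \<Longrightarrow> 0 \<le> NW b"
  shows "(\<lambda>t. K_functional UNIV norm W NW t x) \<in> borel_measurable haar_pos"
proof (subst measurable_cong_sets[OF sets_haar_pos refl], rule borel_measurable_mono_on_fnc)
  show "mono_on {0<..} (\<lambda>t. K_functional UNIV norm W NW t x)"
  proof (rule mono_onI)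
    fix s t :: real assume st: "s \<in> {0<..}" "t \<in> {0<..}" "s \<le> t"
    show "K_functional UNIV norm W NW s x \<le> K_functional UNIV norm W NW t x"
    proof (rule K_functional_ge[OF W])
      fix a b assume "b \<in> W" "x = a + b"
      then have "K_functional UNIV norm W NW s x \<le> norm a + s * NW b"
        using K_functional_le[of W NW s b x] NW st by simp
      also have "\<dots> \<le> norm a + t * NW b"
        using NW[OF \<open>b \<in> W\<close>] st by (simp add: mult_right_mono)
      finally show "K_functional UNIV norm W NW s x \<le> norm a + t * NW b" .
    qed
  qed
qed

text \<open>The summand \<open>min 1 s * N x\<close> is responsible for the extra \<open>N x\<close> in the second norm, since
  \<open>s powr (- \<theta>) * min 1 s\<close> has finite nonzero norm.\<close>

lemma weighted_Lp_comparison: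
  fixes k \<psi> :: "'x \<Rightarrow> real \<Rightarrow> real" and N :: "'x \<Rightarrow> real" and \<theta> :: real
  assumes \<theta>: "0 < \<theta>" "\<theta> < 1" and p: "1 \<le> p" and n: "n \<ge> 1" and C: "C > 0"
    and k_meas: "\<And>x. k x \<in> borel_measurable haar_pos"
    and \<psi>_meas: "\<And>x. \<psi> x \<in> borel_measurable haar_pos"
    and \<psi>_nonneg: "\<And>x t. t > 0 \<Longrightarrow> 0 \<le> \<psi> x t" and N_nonneg: "\<And>x. 0 \<le> N x"
    and \<psi>_le: "\<And>x t. t > 0 \<Longrightarrow> \<psi> x t \<le> C * k x (t powr (- real n))"
    and N_le: "\<And>x s. s > 0 \<Longrightarrow> min 1 s * N x \<le> k x s"
    and k_le: "\<And>x t. t > 0 \<Longrightarrow>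
      k x (t powr (- real n)) \<le> C * (\<psi> x t + min 1 (t powr (- real n)) * N x)"
  defines "k' \<equiv> \<lambda>x s. s powr (- \<theta>) * k x s"
    and "\<psi>' \<equiv> \<lambda>x t. t powr (real n * \<theta>) * \<psi> x t"
  shows "in_Lp p haar_pos (k' x) \<longleftrightarrow> in_Lp p haar_pos (\<psi>' x)"
    and "equivalent_norms_on {x. in_Lp p haar_pos (k' x)}
      (\<lambda>x. Lp_norm p haar_pos (k' x)) (\<lambda>x. N x + Lp_norm p haar_pos (\<psi>' x))"
proof -
  let ?L = "Lp_norm p haar_pos"
  \<comment> \<open>Substituting t = s^(-1/n) turns the weight t^(n \<theta>) into s^(-\<theta>),
    the weight carried by \<open>k\<close>.\<close>
  define \<phi> where "\<phi> x s = s powr (- \<theta>) * \<psi> x (s powr (- inverse (real n)))" for x s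
  define g where "g s = s powr (- \<theta>) * min 1 s" for s :: real
  \<comment> \<open>The change of the L^p norm under the substitution: the density 1/n to the power
    1/p.\<close>
  define \<kappa> where "\<kappa> = (if p = \<infinity> then 1 else inverse \<bar>- real n\<bar> powr (1 / enn2real p))"
  have \<kappa>: "\<kappa> > 0" using n by (simp add: \<kappa>_def)
  have g: "in_Lp p haar_pos g" unfolding g_def by (rule in_Lp_powr_min[OF \<theta> p])
  have gpos: "0 < ?L g"
    using Lp_norm_pos[OF p g _ emeasure_haar_pos] by (simp add: g_def)
  have inv: "(s powr (- inverse (real n))) powr (- real n) = s"
    "(s powr (- real n)) powr (- inverse (real n)) = s" if "s > 0" for s :: real
    using that n by (simp_all add: powr_powr)
  have k'_meas: "k' x \<in> borel_measurable haar_pos" for x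
    unfolding k'_def by (intro borel_measurable_times k_meas borel_measurable_haar_pos) simp
  have \<phi>_meas: "\<phi> x \<in> borel_measurable haar_pos" for x
    unfolding \<phi>_def
    by (intro borel_measurable_times borel_measurable_haar_pos[of "\<lambda>s. s powr (- \<theta>)"]
        measurable_compose[OF powr_measurable_haar_pos \<psi>_meas]) simp
  have eq: "\<psi>' x t = \<phi> x (t powr (- real n))" if "t \<in> space haar_pos" for x t
    using that inv(2)[of t] by (simp add: \<psi>'_def \<phi>_def powr_powr)
  have \<psi>'_iff: "in_Lp p haar_pos (\<psi>' x) \<longleftrightarrow> in_Lp p haar_pos (\<phi> x)" for x
    using Lp_cong(1)[OF p, of haar_pos "\<psi>' x", OF eq] Lp_haar_pos_powr(1)[OF _ \<phi>_meas, of "- real n" p] n by simp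
  have \<psi>'_norm: "?L (\<psi>' x) = \<kappa> * ?L (\<phi> x)" if "in_Lp p haar_pos (\<phi> x)" for x
    using Lp_cong(2)[OF p, of haar_pos "\<psi>' x", OF eq] Lp_haar_pos_powr[OF _ \<phi>_meas, of "- real n" p] n that
    by (simp add: \<kappa>_def)
  have \<phi>_le: "\<bar>\<phi> x s\<bar> \<le> C * \<bar>k' x s\<bar>" if "s \<in> space haar_pos" for x s
  proof -
    let ?t = "s powr (- inverse (real n))"
    have s: "s > 0" and t: "?t > 0" using that by auto
    have "\<bar>\<phi> x s\<bar> = s powr (- \<theta>) * \<psi> x ?t" using \<psi>_nonneg[OF t] by (simp add: \<phi>_def abs_mult)
    also have "\<dots> \<le> s powr (- \<theta>) * (C * k x s)"
      using \<psi>_le[OF t] inv(1)[OF s] by (intro mult_left_mono) auto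
    also have "\<dots> = C * k' x s" by (simp add: k'_def)
    also have "\<dots> \<le> C * \<bar>k' x s\<bar>" using C by simp
    finally show ?thesis .
  qed
  \<comment> \<open>In the norm this recovers \<open>N x\<close> from \<open>k' x\<close>, because
    \<open>g\<close> has positive norm.\<close>
  have g_le: "\<bar>N x * g s\<bar> \<le> 1 * \<bar>k' x s\<bar>" if "s \<in> space haar_pos" for x s
  proof -
    have s: "s > 0" using that by simp
    have "\<bar>N x * g s\<bar> = s powr (- \<theta>) * (min 1 s * N x)"
      using N_nonneg s by (simp add: g_def abs_mult mult_ac)
    also have "\<dots> \<le> k' x s"
      unfolding k'_def using N_le[OF s] by (intro mult_left_mono) auto
    finally show ?thesis by simp
  qed
  have k'_le: "\<bar>k' x s\<bar> \<le> C * \<bar>\<phi> x s + N x * g s\<bar>" if "s \<in> space haar_pos" for x s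
  proof -
    let ?t = "s powr (- inverse (real n))"
    have s: "s > 0" and t: "?t > 0" using that by auto
    have "0 \<le> min 1 s * N x" using N_nonneg[of x] s by simp
    then have "0 \<le> k x s" using N_le[OF s, of x] by (rule order_trans)
    then have "\<bar>k' x s\<bar> = s powr (- \<theta>) * k x s" by (simp add: k'_def abs_mult)
    also have "\<dots> \<le> s powr (- \<theta>) * (C * (\<psi> x ?t + min 1 s * N x))"
      using k_le[OF t] inv(1)[OF s] by (intro mult_left_mono) auto
    also have "\<dots> = C * (\<phi> x s + N x * g s)" by (simp add: \<phi>_def g_def algebra_simps)
    also have "\<dots> \<le> C * \<bar>\<phi> x s + N x * g s\<bar>" using C by simp
    finally show ?thesis .
  qed
  have \<phi>_in: "in_Lp p haar_pos (\<phi> x)" and \<phi>_norm: "?L (\<phi> x) \<le> C * ?L (k' x)"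
    if "in_Lp p haar_pos (k' x)" for x
    using Lp_mono[OF \<phi>_meas that p _ \<phi>_le] C by auto
  have k'_in: "in_Lp p haar_pos (k' x)"
    and k'_norm: "?L (k' x) \<le> C * (4 * (?L (\<phi> x) + N x * ?L g))"
    if "in_Lp p haar_pos (\<phi> x)" for x
  proof -
    note sum = Lp_add[OF p that in_Lp_scale[OF p g, of "N x"]]
    show "in_Lp p haar_pos (k' x)"
      using Lp_mono(1)[OF k'_meas sum(1) p _ k'_le] C by simp
    have "?L (k' x) \<le> C * ?L (\<lambda>s. \<phi> x s + N x * g s)"
      using Lp_mono(2)[OF k'_meas sum(1) p _ k'_le] C by simp
    also have "\<dots> \<le> C * (4 * (?L (\<phi> x) + N x * ?L g))"
      using sum(2) C N_nonneg[of x] by (simp add: Lp_norm_scale[OF p g])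
    finally show "?L (k' x) \<le> C * (4 * (?L (\<phi> x) + N x * ?L g))" .
  qed
  show iff: "in_Lp p haar_pos (k' x) \<longleftrightarrow> in_Lp p haar_pos (\<psi>' x)"
    using \<psi>'_iff \<phi>_in k'_in by blast
  have N_norm: "N x * ?L g \<le> ?L (k' x)" if "in_Lp p haar_pos (k' x)" for x
    using Lp_mono(2)[OF in_Lp_measurable[OF in_Lp_scale[OF p g]] that p _ g_le[of _ x]] N_nonneg[of x]
    by (simp add: Lp_norm_scale[OF p g])
  \<comment> \<open>\<open>d\<close> dominates 1/\<kappa> and the norm of \<open>g\<close>, the two
    coefficients left in \<open>k'_norm\<close> once \<phi> is expressed by \<open>\<psi>'\<close>.
    The 4 in \<open>A\<close> is that of \<open>Lp_add\<close>.\<close>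
  define d where "d = 1 / \<kappa> + ?L g"
  define A where "A = 4 * C * d"
  have A: "A > 0" using C \<kappa> gpos by (simp add: A_def d_def add_pos_pos)
  have lower: "1 / A * ?L (k' x) \<le> N x + ?L (\<psi>' x)" if "in_Lp p haar_pos (k' x)" for x
  proof -
    have \<phi>: "?L (\<phi> x) = ?L (\<psi>' x) / \<kappa>" using \<psi>'_norm[OF \<phi>_in[OF that]] \<kappa> by simp
    have "?L (k' x) \<le> 4 * C * (1 / \<kappa> * ?L (\<psi>' x) + ?L g * N x)"
      using k'_norm[OF \<phi>_in[OF that]] by (simp add: \<phi> mult_ac)
    also have "\<dots> \<le> 4 * C * (d * ?L (\<psi>' x) + d * N x)"
      unfolding d_def using C \<kappa> gpos N_nonneg[of x] Lp_norm_nonneg[of p haar_pos "\<psi>' x"]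
      by (intro mult_left_mono add_mono mult_right_mono) auto
    also have "\<dots> = A * (N x + ?L (\<psi>' x))" by (simp add: A_def algebra_simps)
    finally show ?thesis using A by (simp add: field_simps)
  qed
  have upper: "N x + ?L (\<psi>' x) \<le> (1 / ?L g + \<kappa> * C) * ?L (k' x)" if "in_Lp p haar_pos (k' x)" for x
  proof -
    have "N x \<le> 1 / ?L g * ?L (k' x)" using N_norm[OF that] gpos by (simp add: field_simps)
    moreover have "?L (\<psi>' x) \<le> \<kappa> * C * ?L (k' x)"
      using \<psi>'_norm[OF \<phi>_in[OF that]] \<phi>_norm[OF that] \<kappa> by simp
    ultimately show ?thesis by (simp add: distrib_right)
  qed
  have "1 / ?L g + \<kappa> * C > 0" using C \<kappa> gpos by (simp add: add_pos_pos)
  then show "equivalent_norms_on {x. in_Lp p haar_pos (k' x)}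
      (\<lambda>x. ?L (k' x)) (\<lambda>x. N x + ?L (\<psi>' x))"
    unfolding equivalent_norms_on_def using lower upper A
    by (intro exI[of _ "1 / A"] conjI exI[of _ "1 / ?L g + \<kappa> * C"]) auto
qed

section \<open>Pointwise comparison of the K-functional with \<open>\<Psi>\<close>\<close>

context ray_resolvent
begin

abbreviation K :: "nat \<Rightarrow> real \<Rightarrow> 'a \<Rightarrow> real" where
  "K n \<equiv> K_functional UNIV norm (power_dom D T n) (\<lambda>x. norm x + norm ((T ^^ n) x))"

lemma zero_power_dom: "0 \<in> power_dom D T n"
proof -
  have "0 \<in> power_dom D T n \<and> (T ^^ n) 0 = 0"
    by (induction n) (auto simp: D_closed)
  then show ?thesis ..
qed

lemma powr_minus_nat: "t > 0 \<Longrightarrow> t powr (- real n) = 1 / t ^ n" for t :: real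
  by (simp add: powr_minus powr_realpow divide_inverse)

text \<open>The graph norm is at least \<open>norm b\<close>, and a splitting priced by |a| + s |b|
  never costs less than min(1, s) |x|.\<close>

lemma min_norm_le_K:
  assumes s: "s > 0" shows "min 1 s * norm x \<le> K n s x"
proof (rule K_functional_ge[OF zero_power_dom])
  fix a b assume "x = a + b"
  then have "min 1 s * norm x \<le> min 1 s * norm a + min 1 s * norm b"
    using s norm_triangle_ineq[of a b] by (simp flip: distrib_left)
  also have "\<dots> \<le> 1 * norm a + s * (norm b + norm ((T ^^ n) b))"
    using s by (intro add_mono mult_mono) auto
  finally show "min 1 s * norm x \<le> norm a + s * (norm b + norm ((T ^^ n) b))" by simp
qed

text \<open>The infimum over all splittings in \<open>\<Psi>_upper\<close>; at s = t^(-n) the term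
  with T^n b is part of s times the graph norm.\<close>

lemma \<Psi>_le_K:
  obtains C where "C > 0" "\<And>t x. t > 0 \<Longrightarrow> \<Psi> n t x \<le> C * K n (t powr (- real n)) x"
proof -
  obtain C where C: "C > 0" "\<And>t a b. t > 0 \<Longrightarrow> b \<in> power_dom D T n \<Longrightarrow>
    \<Psi> n t (a + b) \<le> C * (norm a + norm ((T ^^ n) b) / t ^ n)"
    using \<Psi>_upper by blast
  have "\<Psi> n t x / C \<le> K n (t powr (- real n)) x" if t: "t > 0" for t x
  proof (rule K_functional_ge[OF zero_power_dom])
    fix a b assume b: "b \<in> power_dom D T n" "x = a + b"
    have "\<Psi> n t x \<le> C * (norm a + norm ((T ^^ n) b) / t ^ n)" using C(2)[OF t b(1)] b(2) by simp
    also have "\<dots> \<le> C * (norm a + t powr (- real n) * (norm b + norm ((T ^^ n) b)))"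
      using C(1) t by (simp add: powr_minus_nat field_simps)
    finally show "\<Psi> n t x / C \<le> norm a + t powr (- real n) * (norm b + norm ((T ^^ n) b))"
      using C(1) by (simp add: field_simps)
  qed
  then show thesis using that[of C] C(1) by (simp add: field_simps)
qed

text \<open>For s = t^(-n) at most 1 the splitting of \<open>\<Psi>_lower\<close> is used, its extra
  cost s |b| being absorbed by min(1, s) |x|. For s > 1 the trivial splitting with b = 0 costs |x|,
  which is min(1, s) |x|.\<close>

lemma K_le_\<Psi>:
  obtains C where "C > 0" "\<And>t x. t > 0 \<Longrightarrow>
    K n (t powr (- real n)) x \<le> C * (\<Psi> n t x + min 1 (t powr (- real n)) * norm x)"
proof -
  obtain C where C: "C > 0" "\<And>t x. t > 0 \<Longrightarrow> \<exists>b\<in>power_dom D T n.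
    norm (x - b) \<le> C * \<Psi> n t x \<and> norm b \<le> C * norm x \<and> norm ((T ^^ n) b) / t ^ n \<le> C * \<Psi> n t x"
    using \<Psi>_lower by blast
  \<comment> \<open>The two \<open>\<Psi>\<close> terms of \<open>\<Psi>_lower\<close> contribute
    \<open>2 * C\<close>; the summand 1 covers the trivial splitting.\<close>
  have "K n (t powr (- real n)) x \<le>
      (2 * C + 1) * (\<Psi> n t x + min 1 (t powr (- real n)) * norm x)" if t: "t > 0" for t x
  proof -
    define s where "s = t powr (- real n)"
    have s: "s > 0" using t by (simp add: s_def)
    have \<Psi>0: "0 \<le> \<Psi> n t x" using order_trans[OF norm_ge_zero \<Psi>_bounds(1)] .
    have K_le: "K n s x \<le> norm (x - b) + s * (norm b + norm ((T ^^ n) b))"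
      if "b \<in> power_dom D T n" for b
      using that s by (intro K_functional_le) auto
    show ?thesis
    proof (cases "s \<le> 1")
      case True
      obtain b where b: "b \<in> power_dom D T n" "norm (x - b) \<le> C * \<Psi> n t x"
        "norm b \<le> C * norm x" "norm ((T ^^ n) b) / t ^ n \<le> C * \<Psi> n t x"
        using C(2)[OF t] by blast
      have "K n s x \<le> norm (x - b) + s * norm b + norm ((T ^^ n) b) / t ^ n"
        using K_le[OF b(1)] t by (simp add: s_def powr_minus_nat distrib_left)
      also have "\<dots> \<le> C * \<Psi> n t x + s * (C * norm x) + C * \<Psi> n t x"
        using b s by (intro add_mono mult_left_mono) auto
      also have "\<dots> = 2 * C * \<Psi> n t x + C * (s * norm x)" by simp
      also have "\<dots> \<le> (2 * C + 1) * \<Psi> n t x + (2 * C + 1) * (s * norm x)"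
        using C(1) \<Psi>0 s by (intro add_mono mult_right_mono) auto
      also have "\<dots> = (2 * C + 1) * (\<Psi> n t x + min 1 s * norm x)"
        using True by (simp add: distrib_left)
      finally show ?thesis by (simp add: s_def)
    next
      case False
      have "(T ^^ n) 0 = 0" by (induction n) auto
      then have "K n s x \<le> norm x" using K_le[OF zero_power_dom] by simp
      also have "\<dots> \<le> (2 * C + 1) * (\<Psi> n t x + norm x)"
        using mult_mono[of 1 "2 * C + 1" "norm x" "\<Psi> n t x + norm x"] C(1) \<Psi>0 by simp
      finally show ?thesis using False by (simp add: s_def)
    qed
  qed
  then show thesis using that[of "2 * C + 1"] C(1) by simp
qed

theorem real_interpolation_power_dom:
  fixes \<theta> :: real
  assumes \<theta>: "0 < \<theta>" "\<theta> < 1" and p: "1 \<le> p" and n: "n \<ge> 1"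
  shows "in_Lp p haar_pos (\<lambda>t. t powr (- \<theta>) * K n t x) \<longleftrightarrow>
      in_Lp p haar_pos (\<lambda>t. t powr (real n * \<theta>) * \<Psi> n t x)"
    and "equivalent_norms_on {x. in_Lp p haar_pos (\<lambda>t. t powr (- \<theta>) * K n t x)}
      (\<lambda>x. Lp_norm p haar_pos (\<lambda>t. t powr (- \<theta>) * K n t x))
      (\<lambda>x. norm x + Lp_norm p haar_pos (\<lambda>t. t powr (real n * \<theta>) * \<Psi> n t x))"
proof -
  obtain C1 where C1: "C1 > 0" "\<And>t x. t > 0 \<Longrightarrow> \<Psi> n t x \<le> C1 * K n (t powr (- real n)) x"
    using \<Psi>_le_K by blast
  obtain C2 where C2: "C2 > 0" "\<And>t x. t > 0 \<Longrightarrow>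
      K n (t powr (- real n)) x \<le> C2 * (\<Psi> n t x + min 1 (t powr (- real n)) * norm x)"
    using K_le_\<Psi> by blast
  have \<Psi>0: "0 \<le> \<Psi> n t x" for t x using order_trans[OF norm_ge_zero \<Psi>_bounds(1)] .
  have K0: "0 \<le> K n s x" if "s > 0" for s x
    using order_trans[OF _ min_norm_le_K[OF that]] that by simp
  have meas: "(\<lambda>t. K n t x) \<in> borel_measurable haar_pos" for x
    by (rule K_functional_measurable[OF zero_power_dom]) simp
  have \<psi>_meas: "(\<lambda>t. \<Psi> n t x) \<in> borel_measurable haar_pos" for x
    by (subst measurable_cong_sets[OF sets_haar_pos refl])
      (rule borel_measurable_continuous_on_restrict[OF continuous_\<Psi>])
  have le1: "\<Psi> n t x \<le> (C1 + C2) * K n (t powr (- real n)) x" if t: "t > 0" for t x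
    using C1(2)[OF t, of x] C2(1) K0[of "t powr (- real n)" x] t by (simp add: distrib_right add_increasing2)
  have le2: "K n (t powr (- real n)) x \<le> (C1 + C2) * (\<Psi> n t x + min 1 (t powr (- real n)) * norm x)"
    if t: "t > 0" for t x
    using C2(2)[OF t, of x] C1(1) \<Psi>0[of t x]
    by (intro order_trans[OF _ mult_right_mono[of C2 "C1 + C2"]]) auto
  note * = weighted_Lp_comparison[where k = "\<lambda>x t. K n t x" and \<psi> = "\<lambda>x t. \<Psi> n t x" and N = norm,
      OF \<theta> p n _ meas \<psi>_meas \<Psi>0 norm_ge_zero le1 min_norm_le_K le2]
  show "in_Lp p haar_pos (\<lambda>t. t powr (- \<theta>) * K n t x) \<longleftrightarrow>
      in_Lp p haar_pos (\<lambda>t. t powr (real n * \<theta>) * \<Psi> n t x)"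
    "equivalent_norms_on {x. in_Lp p haar_pos (\<lambda>t. t powr (- \<theta>) * K n t x)}
      (\<lambda>x. Lp_norm p haar_pos (\<lambda>t. t powr (- \<theta>) * K n t x))
      (\<lambda>x. norm x + Lp_norm p haar_pos (\<lambda>t. t powr (real n * \<theta>) * \<Psi> n t x))"
    using * C1(1) C2(1) by simp_all
qed

end

section \<open>Quaternionic operators\<close>

lemma linear_of_right_linear_on:
  assumes "right_linear_on UNIV A" shows "linear A"
proof (rule linearI)
  show "A (x + y) = A x + A y" for x y using assms by (simp add: right_linear_on_def)
  show "A (r *\<^sub>R x) = r *\<^sub>R A x" for r x
    using assms by (simp add: right_linear_on_def flip: scaleQ_of_real)
qed

lemma bounded_linear_of_bounded_right_linear:
  assumes "bounded_right_linear A" shows "bounded_linear A"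
proof -
  obtain C where "\<And>x. norm (A x) \<le> C * norm x"
    using assms by (auto simp: bounded_right_linear_def)
  with linear_of_right_linear_on[of A] assms show ?thesis
    by (intro bounded_linear.intro bounded_linear_axioms.intro)
      (auto simp: bounded_right_linear_def mult.commute)
qed

text \<open>Hence Q at t e^(i \<omega>) has the coefficients 2 t cos \<omega> and t^2 for every unit
  \<open>i\<close>, as the real description of the ray requires.\<close>

lemma quat_cis_imaginary_unit:
  assumes "i \<in> imaginary_units"
  shows "quat_re (quat_cis i \<omega>) = cos \<omega>" "norm (quat_cis i \<omega>) = 1"
proof -
  have i: "quat_re i = 0" "(quat_im1 i)\<^sup>2 + (quat_im2 i)\<^sup>2 + (quat_im3 i)\<^sup>2 = 1"
    using assms norm_quat_power2[of i] by (auto simp: imaginary_units_def)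
  show "quat_re (quat_cis i \<omega>) = cos \<omega>"
    by (simp add: quat_cis_def times_quat_def of_real_def i)
  have "(norm (quat_cis i \<omega>))\<^sup>2 =
      (cos \<omega>)\<^sup>2 + ((quat_im1 i)\<^sup>2 + (quat_im2 i)\<^sup>2 + (quat_im3 i)\<^sup>2) * (sin \<omega>)\<^sup>2"
    by (simp add: norm_quat_power2 quat_cis_def times_quat_def of_real_def i(1) algebra_simps)
  then have "(norm (quat_cis i \<omega>))\<^sup>2 = 1" unfolding i(2) by simp
  then show "norm (quat_cis i \<omega>) = 1"
    using norm_ge_zero[of "quat_cis i \<omega>"] by (simp add: power2_eq_1_iff)
qed

lemma ray_resolventI:
  fixes D :: "'a::right_quaternionic_banach set" and \<omega> M :: real
  assumes T: "right_linear_on D T" and i: "i \<in> imaginary_units"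
    and \<rho>: "S_cone \<omega> \<subseteq> S_resolvent_set D T"
    and M: "\<And>s. s \<in> S_cone \<omega> \<Longrightarrow> onorm (Q_inv D T s) \<le> M / (norm s)\<^sup>2"
      "\<And>s. s \<in> S_cone \<omega> \<Longrightarrow> bounded_right_linear (T \<circ> Q_inv D T s) \<and>
            onorm (T \<circ> Q_inv D T s) \<le> M / norm s"
  shows "ray_resolvent D T (cos \<omega>) M (\<lambda>t. Q_inv D T (of_real t * quat_cis i \<omega>))"
proof (rule ray_resolvent.intro)
  have D: "0 \<in> D" "\<And>x y. x \<in> D \<Longrightarrow> y \<in> D \<Longrightarrow> x + y \<in> D" "\<And>x s. x \<in> D \<Longrightarrow> x \<bullet>\<^sub>Q s \<in> D"
    using T by (auto simp: right_linear_on_def right_subspace_def)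
  show "subspace D"
    using D by (auto simp: subspace_def simp flip: scaleQ_of_real)
  show "T (x + y) = T x + T y" if "x \<in> D" "y \<in> D" for x y
    using T that by (simp add: right_linear_on_def)
  show "T (r *\<^sub>R x) = r *\<^sub>R T x" if "x \<in> D" for r x
    using T that by (simp add: right_linear_on_def flip: scaleQ_of_real)
  fix t :: real assume t: "t > 0"
  define s where "s = of_real t * quat_cis i \<omega>"
  define R where "R = Q_inv D T s"
  have s_cone: "s \<in> S_cone \<omega>" using t i by (auto simp: S_cone_def s_def)
  have s_norm: "norm s = t" using t quat_cis_imaginary_unit(2)[OF i] by (simp add: s_def norm_mult)
  have s_re: "quat_re s = t * cos \<omega>"
    using quat_cis_imaginary_unit(1)[OF i] by (simp add: s_def times_quat_def of_real_def)
  have s_\<rho>: "bij_betw (Q_op T s) (power_dom D T 2) UNIV" "bounded_right_linear R"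
    using \<rho> s_cone by (auto simp: S_resolvent_set_def R_def)
  have dom2: "y \<in> power_dom D T 2 \<longleftrightarrow> y \<in> D \<and> T y \<in> D" for y
    by (simp add: numeral_2_eq_2)
  have Q: "Q_op T s y = T (T y) - (2 * t * cos \<omega>) *\<^sub>R T y + t\<^sup>2 *\<^sub>R y" for y
    by (simp add: Q_op_def s_norm s_re numeral_2_eq_2 mult.assoc)
  have R_dom: "R x \<in> power_dom D T 2" for x
    using s_\<rho>(1) unfolding R_def Q_inv_def
    by (intro the_inv_into_into) (auto simp: bij_betw_def)
  have QR: "Q_op T s (R x) = x" for x
    using s_\<rho>(1) unfolding R_def Q_inv_def
    by (intro f_the_inv_into_f) (auto simp: bij_betw_def)
  have RQ: "R (Q_op T s y) = y" if "y \<in> power_dom D T 2" for y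
    using s_\<rho>(1) that unfolding R_def Q_inv_def
    by (intro the_inv_into_f_f) (auto simp: bij_betw_def)
  \<comment> \<open>\<open>onorm\<close> yields a pointwise bound once the operator is known to be
    bounded linear over the reals.\<close>
  note bl = bounded_linear_of_bounded_right_linear
  have "linear R" using bl[OF s_\<rho>(2)] by (rule bounded_linear.linear)
  then show "linear (Q_inv D T (of_real t * quat_cis i \<omega>))"
    by (simp add: R_def s_def)
  fix x
  have "norm (R x) \<le> M / t\<^sup>2 * norm x"
  proof -
    have "norm (R x) \<le> onorm R * norm x" by (rule onorm[OF bl[OF s_\<rho>(2)]])
    also have "\<dots> \<le> M / t\<^sup>2 * norm x"
      using M(1)[OF s_cone] unfolding R_def s_norm by (intro mult_right_mono) auto
    finally show ?thesis .
  qed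
  moreover have "norm (T (R x)) \<le> M / t * norm x"
  proof -
    have "norm ((T \<circ> R) x) \<le> onorm (T \<circ> R) * norm x"
      using M(2)[OF s_cone] unfolding R_def by (intro onorm bl) blast
    also have "\<dots> \<le> M / t * norm x"
      using M(2)[OF s_cone] unfolding R_def s_norm by (intro mult_right_mono) auto
    finally show ?thesis by simp
  qed
  ultimately show "norm (Q_inv D T (of_real t * quat_cis i \<omega>) x) \<le> M / t\<^sup>2 * norm x"
    "norm (T (Q_inv D T (of_real t * quat_cis i \<omega>) x)) \<le> M / t * norm x"
    by (simp_all add: R_def s_def)
  show "Q_inv D T (of_real t * quat_cis i \<omega>) x \<in> D"
    "T (Q_inv D T (of_real t * quat_cis i \<omega>) x) \<in> D"
    using R_dom[of x] unfolding dom2 by (simp_all add: R_def s_def)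
  show "T (T (Q_inv D T (of_real t * quat_cis i \<omega>) x)) -
      (2 * t * cos \<omega>) *\<^sub>R T (Q_inv D T (of_real t * quat_cis i \<omega>) x) +
      t\<^sup>2 *\<^sub>R Q_inv D T (of_real t * quat_cis i \<omega>) x = x"
    using QR[of x] unfolding Q by (simp add: R_def s_def)
  show "Q_inv D T (of_real t * quat_cis i \<omega>)
      (T (T y) - (2 * t * cos \<omega>) *\<^sub>R T y + t\<^sup>2 *\<^sub>R y) = y" if "y \<in> D" "T y \<in> D" for y
    using RQ[of y] that unfolding Q dom2 by (simp add: R_def s_def)
qed

theorem theorem3p5:
  fixes D :: "'a::right_quaternionic_banach set" and T :: "'a \<Rightarrow> 'a"
    and \<omega> M \<theta> :: real and n :: nat and p :: ennreal and i :: quat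
  assumes "closed_right_linear D T"
    and "0 \<le> \<omega>" and "\<omega> \<le> pi"
    and "S_cone \<omega> \<subseteq> S_resolvent_set D T"
    and "M \<ge> 0"
    and "\<And>s. s \<in> S_cone \<omega> \<Longrightarrow> onorm (Q_inv D T s) \<le> M / (norm s)\<^sup>2"
    and "\<And>s. s \<in> S_cone \<omega> \<Longrightarrow> bounded_right_linear (T \<circ> Q_inv D T s) \<and>
            onorm (T \<circ> Q_inv D T s) \<le> M / norm s"
    and "n \<ge> 1"
    and "i \<in> imaginary_units"
    and "0 < \<theta>" and "\<theta> < 1"
    and "1 \<le> p"
  shows "interpolation_space UNIV norm (power_dom D T n) (power_graph_norm T n) \<theta> p =
           {x. in_Lp p haar_pos (\<lambda>t. t powr (real n * \<theta>) * psi D T i \<omega> n x t)} \<and>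
         equivalent_norms_on
           (interpolation_space UNIV norm (power_dom D T n) (power_graph_norm T n) \<theta> p)
           (interpolation_norm UNIV norm (power_dom D T n) (power_graph_norm T n) \<theta> p)
           (\<lambda>x. norm x + Lp_norm p haar_pos (\<lambda>t. t powr (real n * \<theta>) * psi D T i \<omega> n x t))"
proof -
  have "right_linear_on D T" using assms(1) by (simp add: closed_right_linear_def)
  then interpret ray_resolvent D T "cos \<omega>" M "\<lambda>t. Q_inv D T (of_real t * quat_cis i \<omega>)"
    by (rule ray_resolventI) fact+
  \<comment> \<open>For positive \<open>t\<close> the powers of \<open>T\<close> against resolvents
    convert into \<open>P\<close> and \<open>S\<close>; for odd \<open>n\<close> the explicit factor
    \<open>t\<close> of \<open>psi\<close> is the one inside \<open>S\<close>.\<close>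
  have psi: "t powr (real n * \<theta>) * psi D T i \<omega> n x t = t powr (real n * \<theta>) * \<Psi> n t x"
    if "t \<in> space haar_pos" for t x
  proof -
    have t: "t > 0" using that by simp
    show ?thesis
    proof (cases "even n")
      case True
      then obtain k where k: "n = 2 * k" by (rule evenE)
      then show ?thesis using R_funpow(2)[OF t, of k x] by (simp add: psi_def \<Psi>_def J_def)
    next
      case False
      then obtain k where k: "n = 2 * k + 1" by (rule oddE)
      have half: "(n + 1) div 2 = Suc k" "n div 2 = k" "n + 1 = 2 * Suc k" using k by simp_all
      show ?thesis
        using R_funpow(2)[OF t, of "Suc k" x] R_funpow_odd(2)[OF t, of k x] False t
        unfolding psi_def Let_def \<Psi>_def J_def half S_def k[symmetric]
        by (simp del: funpow.simps)
    qed
  qed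
  have in_Lp_psi: "in_Lp p haar_pos (\<lambda>t. t powr (real n * \<theta>) * psi D T i \<omega> n x t) \<longleftrightarrow>
      in_Lp p haar_pos (\<lambda>t. t powr (real n * \<theta>) * \<Psi> n t x)" for x
    by (rule Lp_cong(1)[OF assms(12) psi])
  have Lp_norm_psi: "Lp_norm p haar_pos (\<lambda>t. t powr (real n * \<theta>) * psi D T i \<omega> n x t) =
      Lp_norm p haar_pos (\<lambda>t. t powr (real n * \<theta>) * \<Psi> n t x)"
    if "in_Lp p haar_pos (\<lambda>t. t powr (real n * \<theta>) * \<Psi> n t x)" for x
    by (rule Lp_cong(2)[OF assms(12) psi that])
  note char = real_interpolation_power_dom[OF assms(10,11,12,8)]
  \<comment> \<open>The second space lies in the first, so membership in the sum is no
    restriction.\<close>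
  have sum: "{a + b | a b. a \<in> UNIV \<and> b \<in> power_dom D T n} = UNIV"
    using zero_power_dom[of n] by (auto, metis add.right_neutral)
  have space: "interpolation_space UNIV norm (power_dom D T n) (power_graph_norm T n) \<theta> p =
      {x. in_Lp p haar_pos (\<lambda>t. t powr (- \<theta>) * K n t x)}"
    unfolding interpolation_space_def sum by (simp add: power_graph_norm_def[abs_def])
  have norm: "interpolation_norm UNIV norm (power_dom D T n) (power_graph_norm T n) \<theta> p =
      (\<lambda>x. Lp_norm p haar_pos (\<lambda>t. t powr (- \<theta>) * K n t x))"
    by (simp add: interpolation_norm_def[abs_def] power_graph_norm_def[abs_def])
  \<comment> \<open>The norms of the \<open>psi\<close> and \<open>\<Psi>\<close> versions agree
    only for members of L^p; \<open>char(1)\<close> supplies this membership on the interpolation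
    space.\<close>
  have "equivalent_norms_on {x. in_Lp p haar_pos (\<lambda>t. t powr (- \<theta>) * K n t x)}
      (\<lambda>x. Lp_norm p haar_pos (\<lambda>t. t powr (- \<theta>) * K n t x))
      (\<lambda>x. norm x + Lp_norm p haar_pos (\<lambda>t. t powr (real n * \<theta>) * psi D T i \<omega> n x t))"
    using char(2) unfolding equivalent_norms_on_def
    by (simp add: char(1) Lp_norm_psi)
  then show ?thesis
    unfolding space norm using char(1) in_Lp_psi by simp
qed

end
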